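(* Let $\lambda=\sqrt2$. For $z\in[0,1)^2$ the minimal period length $\pi(z)$ is: \begin{itemize} \item $1$ if $z=(0,0)$; \item $4$ if $z=T^m(0,1/2)$, $0\le m\le3$; \item $8$ for the other points of $T^m(D_A)$, $0\le m\le3$; \item $6$ if $z=T^m(0,1/\sqrt2)$, $0\le m\le5$; \item $2\cdot3^n+(-1)^n$ if $S^nR(z)=(1/\sqrt2,1/\sqrt2)$, $n\ge0$; \item $8(2\cdot3^n+(-1)^n)$ for the other points with $S^nR(z)\in D_\alpha$, $n\ge0$; \item $4(3^{n+1}+1+(-1)^n)$ if $S^nR(z)\in\{(1/2,\sqrt2-1),(\sqrt2-1,1/2)\}$, $n\ge0$; \item $8(3^{n+1}+1+(-1)^n)$ for the other points with $S^nR(z)\in D_\beta\cup\hat T(D_\beta)$, $n\ge0$; \item $2\cdot3^{n+1}+4+(-1)^n$ if $S^nR(z)=(\sqrt2-1,\sqrt2-1)$, $n\ge0$; \item $\infty$ if $S^nR(z)\in\mathcal D\setminus\mathcal P$ for all $n\ge0$. \end{itemize}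
   Context: $T:[0,1)^2\to[0,1)^2$ is the bijection $T(x,y)=(y,\{-x+\sqrt2y\})$ ($\{\cdot\}$ applied to a real number is the fractional part). $\pi(z)$ is the least $p\ge1$ with $T^p(z)=z$, and $\infty$ if none exists. $\mathcal D=\{(x,y)\in[0,1)^2:\ \sqrt2-2<x-\sqrt2y<0,\ 0<\sqrt2x-y<2-\sqrt2\}$; $\mathcal R=\{z\in[0,1)^2:T^m(z)\notin\mathcal D\text{ for all }m\ge0\}$. For $z\notin\mathcal R$, $R(z)=T^{r(z)}(z)$ with $r(z)=\min\{m\ge0:T^m(z)\in\mathcal D\}$. $\hat T:\mathcal D\to\mathcal D$ is the first return map of $T$ to $\mathcal D$, $\hat T(z)=R(T(z))$ (a bijection). $D_A=\{(0,y):1-1/\sqrt2<y<1/\sqrt2\}$, $D_\alpha=\{(x,y)\in\mathcal D:x>\sqrt2-1,\ y>\sqrt2-1\}$, $D_\beta=\{(x,\sqrt2-1):\sqrt2-1<x<2-\sqrt2\}$. $U(z)=(\sqrt2-1)z$, and $\mathcal P=\{z\in\mathcal D:\hat T^m(z)\notin U(\mathcal D)\text{ for all }m\in\mathbb Z\}$, which equals $\{(x,y)\in\mathcal D:x,y\ge\sqrt2-1\}$. For $z\in\mathcal D\setminus\mathcal P$ fix $\hat s(z)$ as either $\min\{m\ge0:\hat T^m(z)\in U(\mathcal D)\}$ or $\max\{m\le0:\hat T^m(z)\in U(\mathcal D)\}$ (one that exists), and let $S(z)=U^{-1}\hat T^{\hat s(z)}(z)$, $S:\mathcal D\setminus\mathcal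 P\to\mathcal D$. For $z\notin\mathcal R$: $S^0R(z)=R(z)$, and $S^nR(z)=S(S^{n-1}R(z))$ is defined as long as $S^{n-1}R(z)$ is defined and in $\mathcal D\setminus\mathcal P$. Conditions on $S^nR(z)$ mean for some $n\ge0$ (unless stated otherwise) and include that $z\notin\mathcal R$ and that it is defined. *)

theory Defs
  imports "HOL-Analysis.Analysis" "HOL-Library.Extended_Nat"
begin

type_synonym point = "real \<times> real"

definition unit_square :: "point set" where
  "unit_square = {0..<1} \<times> {0..<1}"

fun T_map :: "point \<Rightarrow> point" where
  "T_map (x, y) = (y, frac (- x + sqrt 2 * y))"

definition min_period :: "point \<Rightarrow> enat" where
  "min_period z =
     (if \<exists>p\<ge>1. (T_map ^^ p) z = z
      then enat (LEAST p. p \<ge> 1 \<and> (T_map ^^ p) z = z) else \<infinity>)"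

definition D_set :: "point set" where
  "D_set = {(x, y). (x, y) \<in> unit_square \<and>
      sqrt 2 - 2 < x - sqrt 2 * y \<and> x - sqrt 2 * y < 0 \<and>
      0 < sqrt 2 * x - y \<and> sqrt 2 * x - y < 2 - sqrt 2}"

definition R_set :: "point set" where
  "R_set = {z \<in> unit_square. \<forall>m. (T_map ^^ m) z \<notin> D_set}"

text \<open>Only meaningful outside \<open>R_set\<close>, where the set of entry times is nonempty.\<close>

definition R_map :: "point \<Rightarrow> point" where
  "R_map z = (T_map ^^ (LEAST m. (T_map ^^ m) z \<in> D_set)) z"

definition T_hat :: "point \<Rightarrow> point" where
  "T_hat z = R_map (T_map z)"

text \<open>Integer iterates of the first return map, which is a bijection of \<open>D_set\<close>.\<close>

definition T_hat_iter :: "int \<Rightarrow> point \<Rightarrow> point" where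
  "T_hat_iter m z =
     (if m \<ge> 0 then (T_hat ^^ nat m) z
      else (inv_into D_set T_hat ^^ nat (- m)) z)"

definition D_A :: "point set" where
  "D_A = {(0, y) | y. 1 - 1 / sqrt 2 < y \<and> y < 1 / sqrt 2}"

definition D_alpha :: "point set" where
  "D_alpha = {(x, y). (x, y) \<in> D_set \<and> x > sqrt 2 - 1 \<and> y > sqrt 2 - 1}"

definition D_beta :: "point set" where
  "D_beta = {(x, sqrt 2 - 1) | x. sqrt 2 - 1 < x \<and> x < 2 - sqrt 2}"

definition U_map :: "point \<Rightarrow> point" where
  "U_map z = (sqrt 2 - 1) *\<^sub>R z"

definition P_set :: "point set" where
  "P_set = {z \<in> D_set. \<forall>m. T_hat_iter m z \<notin> U_map ` D_set}"

text \<open>The time \<open>s z\<close> may be chosen freely, for each point separately, as the first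
  nonnegative or the last nonpositive visit time to \<open>U_map ` D_set\<close>. An admissible choice
  is a function \<open>s\<close> making one of these choices at every point of \<open>D_set - P_set\<close>.\<close>

definition first_nonneg_visit :: "point \<Rightarrow> int \<Rightarrow> bool" where
  "first_nonneg_visit z m \<longleftrightarrow>
     m \<ge> 0 \<and> T_hat_iter m z \<in> U_map ` D_set \<and>
     (\<forall>k\<ge>0. T_hat_iter k z \<in> U_map ` D_set \<longrightarrow> m \<le> k)"

definition last_nonpos_visit :: "point \<Rightarrow> int \<Rightarrow> bool" where
  "last_nonpos_visit z m \<longleftrightarrow>
     m \<le> 0 \<and> T_hat_iter m z \<in> U_map ` D_set \<and>
     (\<forall>k\<le>0. T_hat_iter k z \<in> U_map ` D_set \<longrightarrow> k \<le> m)"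

definition admissible_choice :: "(point \<Rightarrow> int) \<Rightarrow> bool" where
  "admissible_choice s \<longleftrightarrow>
     (\<forall>z \<in> D_set - P_set. first_nonneg_visit z (s z) \<or> last_nonpos_visit z (s z))"

definition S_map :: "(point \<Rightarrow> int) \<Rightarrow> point \<Rightarrow> point" where
  "S_map s z = inv U_map (T_hat_iter (s z) z)"

text \<open>\<open>SnR s n z\<close> is \<open>S\<^sup>n R(z)\<close>, with \<open>None\<close> when this is undefined.\<close>

fun SnR :: "(point \<Rightarrow> int) \<Rightarrow> nat \<Rightarrow> point \<Rightarrow> point option" where
  "SnR s 0 z = (if z \<in> R_set then None else Some (R_map z))"
| "SnR s (Suc n) z =
     (case SnR s n z of
        None \<Rightarrow> None
      | Some w \<Rightarrow> if w \<in> D_set - P_set then Some (S_map s w) else None)"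

end

theory Submission
  imports Defs
begin

text \<open>
Let \<open>D\<close> be the hexagon \<open>D_set\<close>. The map \<open>T\<close> is locally a rotation by an eighth of a turn (in
suitable coordinates) followed by an integer translation, and the induced map \<open>T_hat\<close> on \<open>D\<close>
exchanges very few pieces: the octagon \<open>x, y > sqrt 2 - 1\<close>, on which it is a rotation of order 8
with return time 3; the right part \<open>x > sqrt 2 - 1 \<ge> y\<close>, where it is the cube of that rotation,
with return time 9; the left part \<open>x < sqrt 2 - 1\<close> with return time 5; and the segment
\<open>x = sqrt 2 - 1\<close> with return time 11.

The heart of the matter is a self-similarity. Put \<open>V (x, y) = (sqrt 2 - 1) (y, x)\<close>. Then the first
return map of \<open>T_hat\<close> to \<open>V D\<close> is \<open>V T_hat V\<inverse>\<close> (lemma \<open>renormalization\<close>). The contraction \<open>U\<close>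
alone would conjugate \<open>T_hat\<close> with the inverse of its return map; since swapping coordinates reverses
time, \<open>V\<close> removes the reversal, and \<open>U ^ n\<close>, \<open>V ^ n\<close> differ at most by a swap. Iterating, the return time of
\<open>T\<close> to \<open>V ^ n D\<close> at \<open>V ^ n v\<close> is \<open>height n v\<close>, which depends only on \<open>n\<close> and on the piece of \<open>v\<close>
(lemma \<open>first_return_swap_V_funpow\<close>). Reading off the pieces visited between two returns gives

  \<open>oct (n + 1) = left n\<close>, \<open>right n = 3 oct n\<close>, \<open>left (n + 1) = left n + right n + left n\<close>,
  \<open>edge (n + 1) = left n + edge n + left n\<close>,

a linear recursion with eigenvalues 3 and -1; this is where \<open>2 * 3 ^ n + (-1) ^ n\<close> comes from.

If \<open>v\<close> has minimal period \<open>q\<close> under \<open>T_hat\<close>, the minimal period of \<open>V ^ n v\<close> under \<open>T\<close> is the sum of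
the heights along the \<open>q\<close> points (lemma \<open>min_period_swap_V\<close>). The points \<open>z\<close> and \<open>U ^ n (S ^ n R z)\<close>
lie on one \<open>T\<close>-orbit, so they have the same period, and it remains to look at the points with
\<open>x, y \<ge> sqrt 2 - 1\<close>: the centre of the octagon (\<open>q = 1\<close>), its other points (\<open>q = 8\<close>), the two
boundary segments (\<open>q = 2\<close> at the midpoints, otherwise \<open>q = 4\<close>) and the corner (\<open>q = 1\<close>). If \<open>S\<close> can be
applied for ever, the period of \<open>z\<close> is at least \<open>height n v > n\<close> for suitable \<open>v\<close> and every \<open>n\<close>, hence
infinite.

Two facts make the list exhaustive. An orbit that misses \<open>D\<close> meets a coordinate axis and is one of
the short cycles through the \<open>y\<close>-axis (lemma \<open>resolved_unit_square\<close>); and every point of \<open>D\<close> with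
\<open>x < sqrt 2 - 1\<close> or \<open>y < sqrt 2 - 1\<close> visits \<open>U D\<close> under \<open>T_hat\<close> (lemma \<open>P_set_lower_bounds\<close>).
\<close>

section \<open>First returns of an abstract map\<close>

definition first_return :: "('a \<Rightarrow> 'a) \<Rightarrow> 'a set \<Rightarrow> nat \<Rightarrow> 'a \<Rightarrow> 'a \<Rightarrow> bool" where
  "first_return f X n z w \<longleftrightarrow>
     0 < n \<and> (f ^^ n) z = w \<and> w \<in> X \<and> (\<forall>j. 0 < j \<and> j < n \<longrightarrow> (f ^^ j) z \<notin> X)"

lemma first_return_one: "f z \<in> X \<Longrightarrow> first_return f X (Suc 0) z (f z)"
  by (auto simp: first_return_def)

lemma first_return_trans:
  assumes "first_return f X m z w" "Y \<subseteq> X" "w \<notin> Y" "first_return f Y n w v"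
  shows "first_return f Y (m + n) z v"
  unfolding first_return_def
proof (intro conjI allI impI)
  show "0 < m + n" "v \<in> Y" using assms by (auto simp: first_return_def)
  show "(f ^^ (m + n)) z = v"
    using assms by (auto simp: first_return_def add.commute[of m] funpow_add)
  fix j assume j: "0 < j \<and> j < m + n"
  consider "j < m" | "j = m" | i where "j = i + m" "0 < i" "i < n"
    using j by (metis add.commute less_diff_conv2 linorder_not_less nat_neq_iff
        le_add_diff_inverse2 zero_less_diff less_imp_le add_less_cancel_left)
  thus "(f ^^ j) z \<notin> Y"
    using assms j by cases (auto simp: first_return_def funpow_add)
qed

lemma first_return_step:
  "f z \<notin> X \<Longrightarrow> first_return f X n (f z) w \<Longrightarrow> first_return f X (Suc n) z w"
  using first_return_trans[OF first_return_one[of f z UNIV]] by simp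

text \<open>Inducing twice: if \<open>g\<close>, transported by \<open>h\<close>, is the first return map of \<open>f\<close> to \<open>h ` D\<close>, then first returns
of \<open>g\<close> to a smaller set are first returns of \<open>f\<close>, and the return times add up along the \<open>g\<close>-orbit. With
\<open>Y\<close> a contracted copy of \<open>D\<close> this is the renormalization step, with \<open>Y\<close> a single point it computes periods.\<close>

lemma first_return_induced:
  assumes ret: "\<And>v. v \<in> D \<Longrightarrow> first_return f (h ` D) (l v) (h v) (h (g v))"
    and inj: "inj_on h D" and gD: "\<And>v. v \<in> D \<Longrightarrow> g v \<in> D" and YD: "Y \<subseteq> D"
  shows "first_return g Y k u w \<Longrightarrow> u \<in> D \<Longrightarrow>
     first_return f (h ` Y) (\<Sum>i<k. l ((g ^^ i) u)) (h u) (h w)"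
proof (induction k arbitrary: u)
  case 0
  thus ?case by (simp add: first_return_def)
next
  case (Suc k)
  show ?case
  proof (cases "k = 0")
    case True
    thus ?thesis
      using Suc.prems ret[of u] YD by (auto simp: first_return_def)
  next
    case False
    have gu: "g u \<in> D" "g u \<notin> Y" and ret': "first_return g Y k (g u) w"
      using Suc.prems False gD
      by (auto simp: first_return_def funpow_swap1 simp del: funpow.simps dest: spec[of _ 1] )
        (auto simp: funpow_Suc_right simp del: funpow.simps dest: spec[of _ "Suc _"])
    have "first_return f (h ` Y) (l u + (\<Sum>i<k. l ((g ^^ i) (g u)))) (h u) (h w)"
    proof (rule first_return_trans)
      show "first_return f (h ` D) (l u) (h u) (h (g u))" using ret Suc.prems by simp
      show "h (g u) \<notin> h ` Y" using gu inj YD by (auto simp: inj_on_def)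
      show "first_return f (h ` Y) (\<Sum>i<k. l ((g ^^ i) (g u))) (h (g u)) (h w)"
        by (rule Suc.IH[OF ret' gu(1)])
    qed (use YD in auto)
    thus ?thesis
      by (simp add: sum.lessThan_Suc_shift funpow_swap1 del: sum.lessThan_Suc)
  qed
qed

text \<open>The return times to a point form the multiples of the least one, so a period is minimal as soon as
no maximal proper divisor of it is a period.\<close>

lemma first_return_singletonI:
  assumes "0 < n" "(f ^^ n) z = z" "\<And>p. prime p \<Longrightarrow> p dvd n \<Longrightarrow> (f ^^ (n div p)) z \<noteq> z"
  shows "first_return f {z} n z z"
  unfolding first_return_def
proof (intro conjI allI impI)
  have mult: "(f ^^ (k * m)) z = z" if "(f ^^ m) z = z" for k m
    using that by (induction k) (auto simp: funpow_add)
  fix j assume j: "0 < j \<and> j < n"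
  show "(f ^^ j) z \<notin> {z}"
  proof
    assume "(f ^^ j) z \<in> {z}"
    define d where "d = gcd j n"
    obtain x y where "j * x = n * y + d"
      using bezout_nat[of j n] j by (auto simp: d_def)
    moreover have "(f ^^ (x * j)) z = z" "(f ^^ (y * n)) z = z"
      using mult assms \<open>(f ^^ j) z \<in> {z}\<close> by auto
    ultimately have d: "(f ^^ d) z = z"
      by (metis add.commute comp_apply funpow_add mult.commute)
    have "d \<le> j" unfolding d_def using j by (intro gcd_le1_nat) auto
    hence "d < n" using j by simp
    moreover obtain m where m: "n = d * m" unfolding d_def by (meson dvdE gcd_dvd2)
    ultimately have "m \<noteq> 1" by auto
    then obtain p k where p: "prime p" "m = p * k" using prime_factor_nat by (metis dvdE)
    have "n div p = k * d" using p prime_gt_0_nat[of p] by (simp add: m)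
    thus False using assms(3)[OF p(1)] mult[OF d, of k] p(2) m by simp
  qed
qed (use assms in auto)

lemma min_period_eqI: "first_return T_map {z} n z z \<Longrightarrow> min_period z = enat n"
  unfolding min_period_def first_return_def
  by (auto intro!: Least_equality exI[of _ n]) (metis Suc_le_eq One_nat_def not_le)

section \<open>Arithmetic of the piecewise affine map\<close>

text \<open>The coordinates along the orbit of \<open>(x, y)\<close> lie in
\<open>\<int>[sqrt 2] x + \<int>[sqrt 2] y + \<int>[sqrt 2]\<close>. Inequalities between them are decided by
linear arithmetic over the rationals with \<open>x\<close>, \<open>y\<close>, \<open>r * x\<close>, \<open>r * y\<close> and \<open>r\<close> as unknowns; this is why
hypotheses are supplied together with their multiples by \<open>r\<close>.\<close>

abbreviation (input) r :: real where "r \<equiv> sqrt 2"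

lemma r_mult: "r * r = 2" "r * (r * t) = 2 * t" by (simp_all flip: mult.assoc)

lemma r_bounds: "1414/1000 < r" "r < 1415/1000"
  by (rule real_less_rsqrt, simp add: power2_eq_square) (rule real_less_lsqrt, simp_all add: power2_eq_square)

text \<open>The lower bounds \<open>0 \<le> x\<close> and \<open>0 \<le> y\<close> follow from the strip conditions because
\<open>x = (r * y - x) + r * (r * x - y)\<close>, and symmetrically for \<open>y\<close>.\<close>

lemma D_set_iff: "(x, y) \<in> D_set \<longleftrightarrow>
    0 < r * y - x \<and> r * y - x < 2 - r \<and> 0 < r * x - y \<and> r * x - y < 2 - r \<and> x < 1 \<and> y < 1"
proof -
  have "0 < x" "0 < y" if "0 < r * y - x" "0 < r * x - y"
  proof -
    have "0 < r * (r * y - x)" "0 < r * (r * x - y)"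
      using that by auto
    thus "0 < x" "0 < y" using that by (auto simp: algebra_simps)
  qed
  thus ?thesis by (auto simp: D_set_def unit_square_def)
qed

lemma r_scale: "a < b \<Longrightarrow> r * a < r * b" "a \<le> b \<Longrightarrow> r * a \<le> r * b" by auto

lemma D_ineqs:
  assumes "(x, y) \<in> D_set"
  shows "0 < x" "0 < y" "x < 1" "y < 1" "r * x < r" "r * y < r"
    "x < r * y" "r * y < x + 2 - r" "y < r * x" "r * x < y + 2 - r"
    "r * x < 2 * y" "2 * y < r * x + 2 * r - 2" "r * y < 2 * x" "2 * x < r * y + 2 * r - 2"
proof -
  show *: "x < 1" "y < 1"  "r * x < r" "r * y < r" "x < r * y" "r * y < x + 2 - r" "y < r * x" "r * x < y + 2 - r"
    using assms by (auto simp: D_set_iff)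
  thus "r * x < 2 * y" "2 * y < r * x + 2 * r - 2" "r * y < 2 * x" "2 * x < r * y + 2 * r - 2"
    using *(5-)[THEN r_scale(1)] by (auto simp: algebra_simps r_mult)
  thus "0 < x" "0 < y" using * by auto
qed

text \<open>An orbit segment of \<open>T\<close> is encoded by the list of its successive coordinates, in which every two
neighbours form a point of the orbit. The predicate also requires that the segment is a first return
to \<open>X\<close>: only its last point, and possibly its first, is in \<open>X\<close>.\<close>

fun T_path :: "point set \<Rightarrow> real list \<Rightarrow> bool" where
  "T_path X (x # y # w # l) \<longleftrightarrow> 0 \<le> w \<and> w < 1 \<and> w - r * y + x \<in> \<int> \<and>
     (if l = [] then (y, w) \<in> X else (y, w) \<notin> X \<and> T_path X (y # w # l))"
| "T_path X _ \<longleftrightarrow> False"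

lemma T_map_eqI:
  assumes "0 \<le> w" "w < 1" "w - r * y + x \<in> \<int>"
  shows "T_map (x, y) = (y, w)"
proof -
  have "- x + r * y - w \<in> \<int>"
    using Ints_minus[OF assms(3)] by (simp add: algebra_simps)
  hence "frac (- x + r * y) = w"
    unfolding frac_unique_iff using assms by auto
  thus ?thesis by simp
qed

lemma first_return_T_path:
  "T_path X l \<Longrightarrow> first_return T_map X (length l - 2) (l ! 0, l ! 1)
     (l ! (length l - 2), l ! (length l - 1))"
proof (induction X l rule: T_path.induct)
  case (1 X x y w l)
  hence T: "T_map (x, y) = (y, w)" by (intro T_map_eqI) auto
  show ?case
  proof (cases "l = []")
    case True
    thus ?thesis using 1 T first_return_one[of T_map "(x, y)" X] by simp
  next
    case False
    thus ?thesis using 1 T first_return_step[of T_map "(x, y)" X]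
      by (auto simp: nth_Cons' Suc_diff_Suc)
  qed
qed auto

text \<open>The explicit first return paths to \<open>D_set\<close> from its four pieces. In each case the last two entries
of the list are the image under the induced map.\<close>

lemma path_oct:
  assumes "(x, y) \<in> D_set" "x > r - 1" "y > r - 1"
  shows "T_path D_set [x, y, r * y - x, y - r * x + 1, r - x]"
  using D_ineqs[OF assms(1)] assms(2-)  r_bounds
  by (simp add: D_set_iff algebra_simps r_mult)

lemma path_left:
  assumes "(x, y) \<in> D_set" "x < r - 1"
  shows "T_path D_set [x, y, r*y - x, y - r*x + 1, r - 1 - x, 2 - r - y, x - r*y + r - 1]"
proof -
  have *: "r * x < 2 - r" using r_scale(1)[OF assms(2)] by (auto simp: algebra_simps r_mult)
  show ?thesis
  using D_ineqs[OF assms(1)] assms(2-) * r_bounds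
  by (simp add: D_set_iff algebra_simps r_mult)
qed

text \<open>This is the octagon path run three times: the first two passes through the rotation of order 8 lead
outside \<open>D_set\<close>, the third one back into it.\<close>

lemma path_right:
  assumes "(x, y) \<in> D_set" "x > r - 1" "y \<le> r - 1"
  shows "T_path D_set [x, y, r*y - x, y - r*x + 1, r - x, 1 - y, x - r*y + 1, r*x - y - 1 + r,
    x + 1 - r, y, r*y - x - 1 + r]"
proof -
  have *: "2 - r < r * x" "r * y \<le> 2 - r"
   using r_scale(1)[OF assms(2)]  r_scale(2)[OF assms(3)] by (auto simp: algebra_simps r_mult)
  show ?thesis
  using D_ineqs[OF assms(1)] assms(2-) * r_bounds
  by (simp add: D_set_iff algebra_simps r_mult)
qed

lemma path_edge:
  assumes "(r - 1, y) \<in> D_set"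
  shows "T_path D_set [r - 1, y, r*y - r + 1, y - 1 + r, 0, 2 - r - y, 2*r - 2 - r*y,
    2 - r - y, 0, y - 1 + r, 1 - r + r * y, y, r - 1]"
  using D_ineqs[OF assms(1)] r_bounds
  by (simp add: D_set_iff algebra_simps r_mult)

section \<open>The induced map and its self-similarity\<close>

text \<open>The similarity that conjugates the induced map with its own first return map to a smaller copy of
\<open>D_set\<close>. The swap compensates for the reversal of time caused by the contraction alone.\<close>

definition swap_V :: "point \<Rightarrow> point" where
  "swap_V z = (sqrt 2 - 1) *\<^sub>R prod.swap z"

lemma T_hat_eqI:
  assumes "first_return T_map D_set n z w"
  shows "T_hat z = w"
proof -
  have n: "n = Suc (n - 1)" using assms by (auto simp: first_return_def)
  have eq: "(T_map ^^ j) (T_map z) = (T_map ^^ Suc j) z" for j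
    by (simp add: funpow_swap1)
  have "(LEAST m. (T_map ^^ m) (T_map z) \<in> D_set) = n - 1"
  proof (rule Least_equality)
    show "(T_map ^^ (n - 1)) (T_map z) \<in> D_set"
      using assms n unfolding eq by (auto simp: first_return_def)
    fix j assume "(T_map ^^ j) (T_map z) \<in> D_set"
    hence "\<not> Suc j < n"
      using assms unfolding eq first_return_def by (metis zero_less_Suc)
    thus "n - 1 \<le> j" by simp
  qed
  thus ?thesis
    using assms n unfolding T_hat_def R_map_def eq by (simp add: first_return_def)
qed

lemma return_oct:
  assumes "(x, y) \<in> D_set" "x > r - 1" "y > r - 1"
  shows "first_return T_map D_set 3 (x, y) (y - r * x + 1, r - x)"
  using first_return_T_path[OF path_oct[OF assms]] by (simp add: eval_nat_numeral)

lemma return_left: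
  assumes "(x, y) \<in> D_set" "x < r - 1"
  shows "first_return T_map D_set 5 (x, y) (2 - r - y, x - r*y + r - 1)"
  using first_return_T_path[OF path_left[OF assms]] by (simp add: eval_nat_numeral)

lemma return_right:
  assumes "(x, y) \<in> D_set" "x > r - 1" "y \<le> r - 1"
  shows "first_return T_map D_set 9 (x, y) (y, r*y - x - 1 + r)"
  using first_return_T_path[OF path_right[OF assms]] by (simp add: eval_nat_numeral)

lemma return_edge:
  assumes "(r - 1, y) \<in> D_set"
  shows "first_return T_map D_set 11 (r - 1, y) (y, r - 1)"
  using first_return_T_path[OF path_edge[OF assms]] by (simp add: eval_nat_numeral)

text \<open>Return times of \<open>T\<close> to the \<open>n\<close>-th contracted copy of \<open>D_set\<close>. Since the left piece at level \<open>n\<close> plays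
the role of the octagon at level \<open>n + 1\<close>, a single second order recursion serves both.\<close>

fun height_oct :: "nat \<Rightarrow> nat" where
  "height_oct 0 = 3"
| "height_oct (Suc 0) = 5"
| "height_oct (Suc (Suc n)) = 2 * height_oct (Suc n) + 3 * height_oct n"

fun height_edge :: "nat \<Rightarrow> nat" where
  "height_edge 0 = 11"
| "height_edge (Suc n) = 2 * height_oct (Suc n) + height_edge n"

fun height :: "nat \<Rightarrow> point \<Rightarrow> nat" where
  "height n (x, y) =
     (if x < r - 1 then height_oct (Suc n)
      else if x = r - 1 then height_edge n
      else if r - 1 < y then height_oct n
      else 3 * height_oct n)"

lemma height_oct_closed: "int (height_oct n) = 2 * 3 ^ n + (-1) ^ n"
  by (induction n rule: height_oct.induct) auto

lemma height_edge_closed: "int (height_edge n) = 2 * 3 ^ (n + 1) + 4 + (-1) ^ n"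
  by (induction n) (auto simp: height_oct_closed)

lemma first_return_T_hat:
  assumes "z \<in> D_set"
  shows "first_return T_map D_set (height 0 z) z (T_hat z)"
proof -
  obtain x y where z: "z = (x, y)" by (cases z)
  consider "x < r - 1" | "x = r - 1" | "x > r - 1" "y > r - 1" | "x > r - 1" "y \<le> r - 1"
    by linarith
  hence "\<exists>w. first_return T_map D_set (height 0 z) z w"
  proof cases
    case 1
    thus ?thesis using assms return_left[of x y] by (auto simp: z)
  next
    case 2
    thus ?thesis using assms return_edge[of y] by (auto simp: z)
  next
    case 3
    thus ?thesis using assms return_oct[of x y] by (auto simp: z)
  next
    case 4
    thus ?thesis using assms return_right[of x y] by (auto simp: z)
  qed
  thus ?thesis using T_hat_eqI by metis
qed

lemmas T_hat_oct = return_oct[THEN T_hat_eqI]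
   and T_hat_left = return_left[THEN T_hat_eqI]
   and T_hat_right = return_right[THEN T_hat_eqI]
   and T_hat_vertical = return_edge[THEN T_hat_eqI]

lemma T_hat_in_D: "z \<in> D_set \<Longrightarrow> T_hat z \<in> D_set"
  using first_return_T_hat[of z] by (auto simp: first_return_def)

lemma swap_V_Pair: "swap_V (x, y) = (r * y - y, r * x - x)"
  by (simp add: swap_V_def algebra_simps)

lemma inj_swap_V: "inj swap_V"
  by (auto simp: inj_def swap_V_def)

lemma r_pred_scale: "a < b \<Longrightarrow> r * a - a < r * b - b"
  using mult_strict_left_mono[of a b "r - 1"] r_bounds by (simp add: algebra_simps)

lemma swap_V_in_D:
  assumes "v \<in> D_set" shows "swap_V v \<in> D_set"
proof -
  obtain x y where v: "v = (x, y)" by (cases v)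
  note D = D_ineqs[OF assms[unfolded v]]
  show ?thesis
    using D r_bounds D(7-10)[THEN r_pred_scale] D(3,4)[THEN r_pred_scale]
    by (simp add: v swap_V_Pair D_set_iff algebra_simps r_mult)
qed

lemma swap_V_image_iff: "(x, y) \<in> swap_V ` D_set \<longleftrightarrow> (r * y + y, r * x + x) \<in> D_set"
proof -
  have *: "swap_V (r * y + y, r * x + x) = (x, y)"
    by (simp add: swap_V_Pair algebra_simps r_mult)
  show ?thesis
  proof
    assume "(x, y) \<in> swap_V ` D_set"
    then obtain v where "v \<in> D_set" "swap_V v = (x, y)" by auto
    with * show "(r * y + y, r * x + x) \<in> D_set" using inj_swap_V by (metis injD)
  next
    assume "(r * y + y, r * x + x) \<in> D_set"
    thus "(x, y) \<in> swap_V ` D_set" using * by (metis image_eqI)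
  qed
qed

text \<open>The rotation of order 8 about \<open>(1 / r, 1 / r)\<close> that the induced map performs on the octagon. It makes sense
on the whole plane, and the affine formula is also used outside \<open>D_set\<close>.\<close>

definition oct_rot :: "point \<Rightarrow> point" where
  "oct_rot z = (1 + snd z - r * fst z, r - fst z)"

text \<open>The first coordinate of \<open>swap_V (a, b)\<close> is \<open>(r - 1) * b\<close>, so its position relative to the line
\<open>x = r - 1\<close> that separates the pieces is decided by comparing \<open>b\<close> with 1.\<close>

lemma swap_V_fst_cmp:
  "r * b - b < r - 1 \<longleftrightarrow> b < 1" "r * b - b = r - 1 \<longleftrightarrow> b = 1" "r - 1 < r * b - b \<longleftrightarrow> 1 < b"
proof -
  have [simp]: "r * b - b = (r - 1) * b" "r > 1" by (simp_all add: algebra_simps)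
  show "r * b - b < r - 1 \<longleftrightarrow> b < 1" "r * b - b = r - 1 \<longleftrightarrow> b = 1" "r - 1 < r * b - b \<longleftrightarrow> 1 < b"
    using mult_less_cancel_left_pos[of "r - 1" b 1] mult_less_cancel_left_pos[of "r - 1" 1 b]
    mult_cancel_left[of "r - 1" b 1] by simp_all
qed

lemma height_swap_V:
  "height n (swap_V (a, b)) =
     (if b < 1 then height_oct (Suc n) else if b = 1 then height_edge n
      else if 1 < a then height_oct n else 3 * height_oct n)"
  by (simp add: swap_V_Pair swap_V_fst_cmp)

text \<open>In the contracted coordinates the branch of the induced map on the left piece becomes the rotation
of the octagon. This coincidence of two affine maps is the source of the self-similarity.\<close>

lemma T_hat_swap_V_left:
  assumes "swap_V (a, b) \<in> D_set" "b < 1"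
  shows "T_hat (swap_V (a, b)) = swap_V (oct_rot (a, b))"
  using T_hat_left[OF assms(1)[unfolded swap_V_Pair]] assms(2)
  by (simp add: swap_V_fst_cmp swap_V_Pair oct_rot_def) (simp add: algebra_simps r_mult)

lemma T_hat_swap_V_right:
  assumes "swap_V (a, b) \<in> D_set" "1 < b" "a \<le> 1"
  shows "T_hat (swap_V (a, b)) = swap_V (r * a - b + 1, a)"
proof -
  have "r * a - a \<le> r - 1" using swap_V_fst_cmp(3)[of a] assms(3) by linarith
  thus ?thesis
    using T_hat_right[OF assms(1)[unfolded swap_V_Pair]] assms(2)
    by (simp add: swap_V_fst_cmp swap_V_Pair) (simp add: algebra_simps r_mult)
qed

lemma T_hat_swap_V_vertical:
  assumes "swap_V (a, 1) \<in> D_set"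
  shows "T_hat (swap_V (a, 1)) = swap_V (1, a)"
  using T_hat_vertical[of "r * a - a"] assms by (simp add: swap_V_Pair)

lemma swap_V_mem_image: "swap_V v \<in> swap_V ` X \<longleftrightarrow> v \<in> X"
  by (rule inj_image_mem_iff[OF inj_swap_V])

lemma first_return_three_steps:
  assumes "f z \<notin> X" "f (f z) \<notin> X" "f (f (f z)) \<in> X"
  shows "first_return f X 3 z (f (f (f z)))"
  using first_return_step[OF assms(1) first_return_step[OF assms(2) first_return_one[of f "f (f z)", OF assms(3)]]]
  by (simp add: eval_nat_numeral)

text \<open>Between two visits to \<open>swap_V ` D_set\<close> the induced map runs through left (from the octagon),
left-left-left (from the right piece, where \<open>T_hat\<close> is the cube of \<open>oct_rot\<close>), left-right-left (from the
left piece) or left-segment-left (from the segment \<open>x = r - 1\<close>). The sum of heights records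
these words and yields the recursion for the heights.\<close>

lemma renormalization:
  assumes "v \<in> D_set"
  shows "\<exists>k. first_return T_hat (swap_V ` D_set) k (swap_V v) (swap_V (T_hat v)) \<and>
    (\<forall>n. (\<Sum>i<k. height n ((T_hat ^^ i) (swap_V v))) = height (Suc n) v)"
proof -
  obtain x y where v: "v = (x, y)" by (cases v)
  note xy = assms[unfolded v]
  note D = D_ineqs[OF xy]
  note VD = swap_V_in_D[OF assms, unfolded v]
  define g where "g = oct_rot (x, y)"
  have g: "g = (1 + y - r * x, r - x)" by (simp add: g_def oct_rot_def)
  have T1: "T_hat (swap_V (x, y)) = swap_V g"
    using T_hat_swap_V_left[OF VD] D unfolding g_def by simp
  have gD: "swap_V g \<in> D_set" using T_hat_in_D[OF VD] T1 by simp
  have ThD: "T_hat (x, y) \<in> D_set" using T_hat_in_D[OF xy] .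
  have three_steps: ?thesis
    if "T_hat (swap_V g) = swap_V h" "T_hat (swap_V h) = swap_V (T_hat (x, y))"
      "g \<notin> D_set" "h \<notin> D_set"
      "\<And>n. height n (swap_V (x, y)) + height n (swap_V g) + height n (swap_V h) = height (Suc n) (x, y)"
    for h
  proof -
    have "first_return T_hat (swap_V ` D_set) 3 (swap_V v) (swap_V (T_hat v))"
      using first_return_three_steps[of T_hat "swap_V (x, y)" "swap_V ` D_set"] that ThD
      by (simp add: T1 swap_V_mem_image v)
    thus ?thesis using that
      by (intro exI[of _ 3]) (simp add: eval_nat_numeral T1 v)
  qed
  consider "x < r - 1" | "x = r - 1" | "x > r - 1" "y > r - 1" | "x > r - 1" "y \<le> r - 1"
    by linarith
  thus ?thesis
  proof cases
    case 3
    have "T_hat (x, y) = g" using T_hat_oct[OF xy] 3 by (simp add: g)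
    hence "first_return T_hat (swap_V ` D_set) (Suc 0) (swap_V v) (swap_V (T_hat v))"
      using first_return_one[of T_hat "swap_V v" "swap_V ` D_set"] T1 ThD by (simp add: v)
    thus ?thesis unfolding v using 3 D
      by (intro exI[of _ "Suc 0"]) (simp add: height_swap_V)
  next
    case 4
    define g2 where "g2 = oct_rot g"
    have g2: "g2 = (1 + x - r * y, r - 1 - y + r * x)"
      by (simp add: g2_def oct_rot_def g) (simp add: algebra_simps r_mult)
    have T2: "T_hat (swap_V g) = swap_V g2"
      using T_hat_swap_V_left[of "fst g" "snd g"] gD 4 by (simp add: g2_def g)
    have g2D: "swap_V g2 \<in> D_set" using T_hat_in_D[OF gD] T2 by simp
    have T3: "T_hat (swap_V g2) = swap_V (T_hat (x, y))"
      using T_hat_swap_V_left[of "fst g2" "snd g2"] g2D D T_hat_right[OF xy] 4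
      by (simp add: g2 oct_rot_def algebra_simps r_mult)
    have nD: "g \<notin> D_set" "g2 \<notin> D_set"
      using 4 by (simp_all add: g g2 D_set_iff algebra_simps r_mult)
    have "height n (swap_V g) = height_oct (Suc n)" "height n (swap_V g2) = height_oct (Suc n)" for n
      using 4 D by (simp_all add: g g2 height_swap_V)
    thus ?thesis using 4 D
      by (intro three_steps[OF T2 T3 nD]) (simp add: height_swap_V)
  next
    case 1
    define g2 where "g2 = (1 + r * y - x, 1 + y - r * x)"
    have T2: "T_hat (swap_V g) = swap_V g2"
      using T_hat_swap_V_right[of "fst g" "snd g"] gD 1 D by (simp add: g2_def g) (simp add: algebra_simps r_mult)
    have g2D: "swap_V g2 \<in> D_set" using T_hat_in_D[OF gD] T2 by simp
    have T3: "T_hat (swap_V g2) = swap_V (T_hat (x, y))"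
      using T_hat_swap_V_left[of "fst g2" "snd g2"] g2D D T_hat_left[OF xy] 1
      by (simp add: g2_def oct_rot_def algebra_simps r_mult)
    have nD: "g \<notin> D_set" "g2 \<notin> D_set"
      using 1 D by (simp_all add: g g2_def D_set_iff)
    have "height n (swap_V g) = 3 * height_oct n" "height n (swap_V g2) = height_oct (Suc n)" for n
      using 1 D by (simp_all add: g g2_def height_swap_V)
    thus ?thesis using 1 D
      by (intro three_steps[OF T2 T3 nD]) (simp add: height_swap_V)
  next
    case 2
    define g2 where "g2 = (1 :: real, 1 + y - r * x)"
    have T2: "T_hat (swap_V g) = swap_V g2"
      using T_hat_swap_V_vertical[of "fst g"] gD 2 by (simp add: g2_def g)
    have g2D: "swap_V g2 \<in> D_set" using T_hat_in_D[OF gD] T2 by simp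
    have T3: "T_hat (swap_V g2) = swap_V (T_hat (x, y))"
    proof -
      have eqs: "1 + y - r * x = y - 1 + r" "T_hat (x, y) = (y, r - 1)"
        using T_hat_vertical xy by (auto simp: 2 algebra_simps r_mult)
      have "y < 2 - r" using D(9) by (simp add: 2 algebra_simps r_mult)
      thus ?thesis
        using T_hat_swap_V_left[of 1 "y - 1 + r"] g2D by (simp add: g2_def eqs oct_rot_def)
    qed
    have nD: "g \<notin> D_set" "g2 \<notin> D_set"
      using 2 by (simp_all add: g g2_def D_set_iff)
    have "height n (swap_V g) = height_edge n" "height n (swap_V g2) = height_oct (Suc n)" for n
      using 2 D by (simp_all add: g g2_def height_swap_V)
    thus ?thesis using 2 D
      by (intro three_steps[OF T2 T3 nD]) (simp add: height_swap_V)
  qed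
qed

lemma inj_swap_V_funpow: "inj (swap_V ^^ n)"
  using inj_swap_V by (induction n) (auto intro: inj_compose)

text \<open>By induction on the level: \<open>renormalization\<close> refines the return map of level \<open>n\<close> to that of level \<open>n + 1\<close>.\<close>

lemma first_return_swap_V_funpow:
  "v \<in> D_set \<Longrightarrow> first_return T_map ((swap_V ^^ n) ` D_set) (height n v)
     ((swap_V ^^ n) v) ((swap_V ^^ n) (T_hat v))"
proof (induction n arbitrary: v)
  case 0
  thus ?case using first_return_T_hat by simp
next
  case (Suc n)
  obtain k where k: "first_return T_hat (swap_V ` D_set) k (swap_V v) (swap_V (T_hat v))"
    and sum: "(\<Sum>i<k. height n ((T_hat ^^ i) (swap_V v))) = height (Suc n) v"
    using renormalization[OF Suc.prems] by auto
  have "first_return T_map ((swap_V ^^ n) ` swap_V ` D_set)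
          (\<Sum>i<k. height n ((T_hat ^^ i) (swap_V v))) ((swap_V ^^ n) (swap_V v))
          ((swap_V ^^ n) (swap_V (T_hat v)))"
    by (rule first_return_induced[where D = D_set and g = T_hat, OF _ _ _ _ k])
       (use Suc inj_swap_V_funpow T_hat_in_D swap_V_in_D in \<open>auto simp: inj_on_def inj_def\<close>)
  thus ?case by (simp add: sum image_comp funpow_swap1 o_def)
qed

section \<open>Time reversal and periods along orbits\<close>

lemma T_map_in_unit_square: "T_map z \<in> unit_square" if "z \<in> unit_square"
  using that by (cases z) (auto simp: unit_square_def frac_lt_1)

lemma T_map_funpow_in_unit_square: "z \<in> unit_square \<Longrightarrow> (T_map ^^ n) z \<in> unit_square"
  by (induction n) (auto intro: T_map_in_unit_square)

lemma D_subset_unit_square: "D_set \<subseteq> unit_square"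
  by (auto simp: D_set_def)

text \<open>Time reversal: \<open>w = frac (- x + r * y)\<close> says that \<open>x + w - r * y\<close> is an integer, a condition symmetric
in \<open>x\<close> and \<open>w\<close>, so the swap conjugates \<open>T_map\<close> with its inverse.\<close>

lemma T_map_swap_T_map:
  assumes "z \<in> unit_square"
  shows "T_map (prod.swap (T_map z)) = prod.swap z"
proof -
  obtain x y where z: "z = (x, y)" by (cases z)
  have "T_map (frac (- x + r * y), y) = (y, x)"
    by (rule T_map_eqI) (use assms in \<open>auto simp: z unit_square_def frac_def\<close>)
  thus ?thesis
    unfolding z T_map.simps(1)[of x y] by (simp del: T_map.simps)
qed

lemma inj_on_T_map: "inj_on T_map unit_square"
  by (rule inj_onI) (metis T_map_swap_T_map swap_swap)

lemma T_map_funpow_swap: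
  "z \<in> unit_square \<Longrightarrow> (T_map ^^ n) (prod.swap ((T_map ^^ n) z)) = prod.swap z"
proof (induction n)
  case (Suc n)
  have "(T_map ^^ Suc n) (prod.swap ((T_map ^^ Suc n) z))
      = (T_map ^^ n) (T_map (prod.swap (T_map ((T_map ^^ n) z))))"
    by (simp add: funpow_swap1)
  thus ?case using Suc T_map_swap_T_map T_map_funpow_in_unit_square by simp
qed simp

lemma inj_on_T_map_funpow: "inj_on (T_map ^^ n) unit_square"
  by (rule inj_onI) (metis T_map_funpow_swap swap_swap)

text \<open>As \<open>T_map ^^ k\<close> is injective and commutes with \<open>T_map\<close>, a point and its image have the same periods.\<close>

lemma min_period_funpow:
  assumes "z \<in> unit_square"
  shows "min_period ((T_map ^^ k) z) = min_period z"
proof -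
  have "(T_map ^^ p) ((T_map ^^ k) z) = (T_map ^^ k) z \<longleftrightarrow> (T_map ^^ p) z = z" for p
  proof -
    have "(T_map ^^ p) ((T_map ^^ k) z) = (T_map ^^ k) ((T_map ^^ p) z)"
      by (metis add.commute comp_apply funpow_add)
    thus ?thesis
      using inj_onD[OF inj_on_T_map_funpow[of k], of "(T_map ^^ p) z" z] assms
        T_map_funpow_in_unit_square by metis
  qed
  thus ?thesis by (simp add: min_period_def)
qed

lemma swap_in_D: "prod.swap z \<in> D_set \<longleftrightarrow> z \<in> D_set"
  by (cases z) (auto simp: D_set_iff)

lemma first_return_swap:
  assumes "first_return T_map D_set n z w" "z \<in> D_set"
  shows "first_return T_map D_set n (prod.swap w) (prod.swap z)"
  unfolding first_return_def
proof (intro conjI allI impI)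
  have z: "z \<in> unit_square" using assms D_subset_unit_square by auto
  show "0 < n" "prod.swap z \<in> D_set" using assms by (auto simp: first_return_def swap_in_D)
  show "(T_map ^^ n) (prod.swap w) = prod.swap z"
    using assms T_map_funpow_swap[OF z, of n] by (auto simp: first_return_def)
  fix j assume j: "0 < j \<and> j < n"
  have "w = (T_map ^^ j) ((T_map ^^ (n - j)) z)"
    using assms j by (auto simp: first_return_def simp flip: funpow_add comp_apply[of "T_map ^^ j"])
  hence "(T_map ^^ j) (prod.swap w) = prod.swap ((T_map ^^ (n - j)) z)"
    using T_map_funpow_swap T_map_funpow_in_unit_square z by metis
  thus "(T_map ^^ j) (prod.swap w) \<notin> D_set"
    using assms j by (auto simp: first_return_def swap_in_D)
qed

lemma T_hat_swap:
  assumes "z \<in> D_set"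
  shows "T_hat (prod.swap (T_hat z)) = prod.swap z"
  using first_return_swap[OF first_return_T_hat] assms T_hat_eqI by blast

lemma inj_on_T_hat: "inj_on T_hat D_set"
  by (rule inj_onI) (metis T_hat_swap swap_swap)

text \<open>Since \<open>D_set\<close> is symmetric, the induced map inherits the time reversal, which provides its inverse
and in particular its surjectivity.\<close>

lemma inv_into_T_hat:
  assumes "z \<in> D_set"
  shows "inv_into D_set T_hat z = prod.swap (T_hat (prod.swap z))"
  using T_hat_swap[of "prod.swap z"] T_hat_in_D[of "prod.swap z"] assms
  by (intro inv_into_f_eq inj_on_T_hat) (auto simp: swap_in_D)

lemma inv_into_T_hat_in_D: "z \<in> D_set \<Longrightarrow> inv_into D_set T_hat z \<in> D_set"
  using T_hat_in_D[of "prod.swap z"] swap_in_D by (auto simp: inv_into_T_hat)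

lemma T_hat_inv_into: "z \<in> D_set \<Longrightarrow> T_hat (inv_into D_set T_hat z) = z"
  using T_hat_swap[of "prod.swap z"] by (simp add: inv_into_T_hat swap_in_D)

lemma U_map_eq: "U_map z = swap_V (prod.swap z)"
  by (simp add: U_map_def swap_V_def)

lemma swap_V_swap: "swap_V (prod.swap z) = prod.swap (swap_V z)"
  by (cases z) (simp add: swap_V_def)

lemma swap_V_funpow_swap: "(swap_V ^^ n) (prod.swap z) = prod.swap ((swap_V ^^ n) z)"
  by (induction n) (auto simp: swap_V_swap)

text \<open>\<open>U_map\<close> is \<open>swap_V\<close> after a swap, and these two commute, so swaps cancel in pairs.\<close>

lemma U_map_funpow: "(U_map ^^ n) z = (swap_V ^^ n) (if even n then z else prod.swap z)"
  by (induction n) (auto simp: U_map_eq swap_V_funpow_swap swap_V_swap)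

lemma image_U_map_D: "U_map ` D_set = swap_V ` D_set"
proof -
  have "prod.swap ` D_set = D_set" using swap_in_D by (auto intro!: image_eqI[of _ prod.swap "prod.swap _"] simp del: swap_simp)
  thus ?thesis by (metis (no_types) U_map_eq image_cong image_image)
qed

lemma swap_V_funpow_in_D: "v \<in> D_set \<Longrightarrow> (swap_V ^^ n) v \<in> D_set"
  by (induction n) (auto intro: swap_V_in_D)

lemma min_period_swap_V_T_hat:
  assumes "v \<in> D_set"
  shows "min_period ((swap_V ^^ n) (T_hat v)) = min_period ((swap_V ^^ n) v)"
  using first_return_swap_V_funpow[OF assms, of n] min_period_funpow[of "(swap_V ^^ n) v" "height n v"]
    swap_V_funpow_in_D[OF assms] D_subset_unit_square by (metis first_return_def subsetD)

text \<open>For odd \<open>n\<close> the step from \<open>v\<close> to \<open>T_hat v\<close> turns into the step from the swap of \<open>T_hat v\<close> to the swap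
of \<open>v\<close>, which is again a step of the induced map.\<close>

lemma min_period_U_T_hat:
  assumes "v \<in> D_set"
  shows "min_period ((U_map ^^ n) (T_hat v)) = min_period ((U_map ^^ n) v)"
  using min_period_swap_V_T_hat[OF assms, of n] T_hat_swap[OF assms] T_hat_in_D[OF assms]
    min_period_swap_V_T_hat[of "prod.swap (T_hat v)" n]
  by (simp add: U_map_funpow swap_in_D)

text \<open>It makes no difference for periods at which visit, forward or backward, the orbit is renormalized;
this accounts for every admissible choice of visit times at once.\<close>

lemma T_hat_iter_orbit:
  assumes "v \<in> D_set"
  shows "T_hat_iter m v \<in> D_set \<and> min_period ((U_map ^^ n) (T_hat_iter m v)) = min_period ((U_map ^^ n) v)"
proof -
  have "(T_hat ^^ k) v \<in> D_set \<and> min_period ((U_map ^^ n) ((T_hat ^^ k) v)) = min_period ((U_map ^^ n) v)" for k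
    by (induction k) (use assms in \<open>auto simp: T_hat_in_D min_period_U_T_hat\<close>)
  moreover have "(inv_into D_set T_hat ^^ k) v \<in> D_set \<and>
      min_period ((U_map ^^ n) ((inv_into D_set T_hat ^^ k) v)) = min_period ((U_map ^^ n) v)" for k
  proof (induction k)
    case (Suc k)
    thus ?case using min_period_U_T_hat[of "inv_into D_set T_hat ((inv_into D_set T_hat ^^ k) v)" n]
      by (auto simp: inv_into_T_hat_in_D T_hat_inv_into)
  qed (use assms in auto)
  ultimately show ?thesis by (simp add: T_hat_iter_def)
qed

lemma U_S_map:
  assumes "admissible_choice s" "w \<in> D_set - P_set"
  shows "S_map s w \<in> D_set" "U_map (S_map s w) = T_hat_iter (s w) w"
proof -
  have "T_hat_iter (s w) w \<in> U_map ` D_set"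
    using assms by (auto simp: admissible_choice_def first_nonneg_visit_def last_nonpos_visit_def)
  moreover have "inj U_map" by (auto simp: inj_def U_map_def)
  ultimately show "S_map s w \<in> D_set" "U_map (S_map s w) = T_hat_iter (s w) w"
    by (auto simp: S_map_def)
qed

text \<open>A point and its successive renormalizations, contracted back to the original scale, lie on one orbit of \<open>T_map\<close>.\<close>

lemma min_period_SnR:
  assumes s: "admissible_choice s" and z: "z \<in> unit_square"
  shows "SnR s n z = Some w \<Longrightarrow> w \<in> D_set \<and> min_period z = min_period ((U_map ^^ n) w)"
proof (induction n arbitrary: w)
  case 0
  then obtain m where m: "(T_map ^^ m) z \<in> D_set" and w: "w = R_map z"
    using z by (auto simp: R_set_def split: if_splits)
  have "R_map z \<in> D_set" unfolding R_map_def using m by (rule LeastI[of "\<lambda>m. (T_map ^^ m) z \<in> D_set"])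
  thus ?case using min_period_funpow[OF z] w by (simp add: R_map_def)
next
  case (Suc n)
  then obtain v where v: "SnR s n z = Some v" "v \<in> D_set - P_set" "w = S_map s v"
    by (auto split: option.splits if_splits)
  have "(U_map ^^ Suc n) w = (U_map ^^ n) (T_hat_iter (s v) v)"
    using U_S_map[OF s v(2)] v(3) by (simp add: funpow_swap1)
  thus ?case using Suc.IH[OF v(1)] v U_S_map[OF s v(2)] T_hat_iter_orbit[of v] by auto
qed

lemma min_period_swap_V:
  assumes "v \<in> D_set" "0 < q" "(T_hat ^^ q) v = v" "\<And>p. prime p \<Longrightarrow> p dvd q \<Longrightarrow> (T_hat ^^ (q div p)) v \<noteq> v"
  shows "min_period ((swap_V ^^ n) v) = enat (\<Sum>i<q. height n ((T_hat ^^ i) v))"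
proof -
  have "first_return T_map ((swap_V ^^ n) ` {v}) (\<Sum>i<q. height n ((T_hat ^^ i) v))
      ((swap_V ^^ n) v) ((swap_V ^^ n) v)"
    by (rule first_return_induced[where D = D_set and g = T_hat])
      (use assms first_return_singletonI[of q T_hat v] inj_swap_V_funpow[of n] in
        \<open>auto simp: inj_on_def inj_def T_hat_in_D first_return_swap_V_funpow\<close>)
  thus ?thesis using min_period_eqI by simp
qed

text \<open>A return to the point itself is a return to the contracted copy of \<open>D_set\<close> that contains it.\<close>

lemma min_period_height_le:
  assumes "v \<in> D_set"
  shows "enat (height n v) \<le> min_period ((swap_V ^^ n) v)"
proof (cases "min_period ((swap_V ^^ n) v)")
  case (enat p)
  let ?z = "(swap_V ^^ n) v"
  have ex: "\<exists>p\<ge>1. (T_map ^^ p) ?z = ?z"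
    using enat by (auto simp: min_period_def split: if_splits)
  hence "p = (LEAST p. p \<ge> 1 \<and> (T_map ^^ p) ?z = ?z)"
    using enat by (auto simp: min_period_def)
  hence "p \<ge> 1" "(T_map ^^ p) ?z = ?z" using LeastI_ex[OF ex[simplified Bex_def]] by auto
  hence "\<not> p < height n v"
    using first_return_swap_V_funpow[OF assms, of n] assms unfolding first_return_def
    by (metis One_nat_def Suc_le_eq image_eqI)
  thus ?thesis using enat by simp
qed simp

lemma less_height_oct: "n < height_oct n"
  by (induction n rule: height_oct.induct) auto

lemma less_height: "n < height n v"
proof -
  have "n < height_edge n"
  proof (induction n)
    case (Suc n)
    thus ?case using less_height_oct[of "Suc n"] by (simp del: height_oct.simps)
  qed simp
  thus ?thesis using less_height_oct[of n] less_height_oct[of "Suc n"] by (cases v) (auto simp del: height_oct.simps)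
qed

section \<open>Orbits that avoid the domain, and visits to its contracted copy\<close>

lemma one_div_r: "1 / r = r / 2"
  by (simp add: field_simps)

lemma min_period_origin: "min_period (0, 0) = 1"
proof -
  have "first_return T_map {(0, 0)} 1 (0, 0) (0, 0)"
    using first_return_T_path[of "{(0, 0)}" "[0, 0, 0]"] by simp
  thus ?thesis by (simp add: min_period_eqI one_enat_def)
qed

lemma first_return_four_cycle: "first_return T_map {(0, 1/2)} 4 (0, 1/2) (0, 1/2)"
  using first_return_T_path[of "{(0, 1/2)}" "[0, 1/2, r/2, 1/2, 0, 1/2]"] r_bounds
  by (simp add: r_mult eval_nat_numeral)

lemma D_A_iff: "z \<in> D_A \<longleftrightarrow> fst z = 0 \<and> 1 - r / 2 < snd z \<and> snd z < r / 2"
  by (cases z) (auto simp: D_A_def one_div_r)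

lemma D_A_scale: "1 - r / 2 < y \<Longrightarrow> r - 1 < r * y" "y < r / 2 \<Longrightarrow> r * y < 1"
  using r_scale(1)[of "1 - r / 2" y] r_scale(1)[of y "r / 2"] by (auto simp: algebra_simps r_mult)

text \<open>Four steps reflect \<open>D_A\<close> in its midpoint, whence period 4 at the midpoint and 8 elsewhere.\<close>

lemma T_map_4_D_A:
  assumes "1 - r / 2 < y" "y < r / 2"
  shows "(T_map ^^ 4) (0, y) = (0, 1 - y)"
  using first_return_T_path[of "{(0, 1 - y)}" "[0, y, r * y, y, 0, 1 - y]"]
    D_A_scale assms r_bounds by (simp add: eval_nat_numeral algebra_simps r_mult first_return_def)

lemma first_return_D_A:
  assumes "1 - r / 2 < y" "y < r / 2" "y \<noteq> 1 / 2"
  shows "first_return T_map {(0, y)} 8 (0, y) (0, y)"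
proof -
  have "T_path {(0, y)} [0, y, r * y, y, 0, 1 - y, r - r * y, 1 - y, 0, y]"
    using D_A_scale[of y] assms r_bounds by (simp add: algebra_simps r_mult)
  from first_return_T_path[OF this] show ?thesis by (simp add: eval_nat_numeral)
qed

lemma first_return_six_cycle: "first_return T_map {(0, 1 / r)} 6 (0, 1 / r) (0, 1 / r)"
proof -
  have "T_path {(0, r/2)} [0, r/2, 0, 1 - r/2, r - 1, 1 - r/2, 0, r/2]"
    using r_bounds by (simp add: algebra_simps r_mult)
  from first_return_T_path[OF this] show ?thesis by (simp add: one_div_r eval_nat_numeral)
qed

text \<open>If \<open>n\<close> steps map \<open>X\<close> onto a superset of itself, the union of the first \<open>n\<close> images of \<open>X\<close> is closed under preimages,
because \<open>T_map\<close> is injective.\<close>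

lemma cycle_backward:
  assumes "X \<subseteq> unit_square" "X \<subseteq> (T_map ^^ n) ` X" "0 < n" "z \<in> unit_square"
    "T_map z \<in> (T_map ^^ m) ` X" "m < n"
  shows "\<exists>m<n. z \<in> (T_map ^^ m) ` X"
proof -
  have "\<exists>m<n. T_map z \<in> (T_map ^^ Suc m) ` X"
  proof (cases m)
    case 0
    hence "T_map z \<in> (T_map ^^ n) ` X" using assms by auto
    thus ?thesis using assms(3) by (intro exI[of _ "n - 1"]) (simp del: funpow.simps)
  next
    case (Suc k)
    thus ?thesis using assms by (intro exI[of _ k]) simp
  qed
  then obtain m a where "m < n" "a \<in> X" "T_map z = T_map ((T_map ^^ m) a)" by auto
  thus ?thesis
    using inj_onD[OF inj_on_T_map] assms T_map_funpow_in_unit_square by (metis image_eqI subsetD)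
qed

text \<open>A point is resolved if its orbit either reaches \<open>D_set\<close> or is one of the exceptional cycles. The property
passes from \<open>T_map z\<close> to \<open>z\<close>, so it suffices to follow each orbit until its fate is known.\<close>

definition resolved :: "point \<Rightarrow> bool" where
  "resolved z \<longleftrightarrow> (\<exists>m. (T_map ^^ m) z \<in> D_set) \<or> z = (0, 0)
     \<or> (\<exists>m\<le>3. z \<in> (T_map ^^ m) ` D_A) \<or> (\<exists>m\<le>5. z = (T_map ^^ m) (0, 1 / sqrt 2))"

lemma resolved_backward:
  assumes z: "z \<in> unit_square" and T: "resolved (T_map z)"
  shows "resolved z"
proof -
  have *: "m \<le> 3 \<longleftrightarrow> m < 4" "m \<le> 5 \<longleftrightarrow> m < 6" for m :: nat by auto
  have eq: "resolved z \<longleftrightarrow> (\<exists>m. (T_map ^^ m) z \<in> D_set) \<or> (\<exists>m<1. z \<in> (T_map ^^ m) ` {(0,0)})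
     \<or> (\<exists>m<4. z \<in> (T_map ^^ m) ` D_A) \<or> (\<exists>m<6. z \<in> (T_map ^^ m) ` {(0, 1 / sqrt 2)})" for z
    by (simp add: resolved_def *)
  have A: "D_A \<subseteq> (T_map ^^ 4) ` D_A"
  proof
    fix a assume "a \<in> D_A"
    thus "a \<in> (T_map ^^ 4) ` D_A"
      using T_map_4_D_A[of "1 - snd a"]
      by (intro image_eqI[of _ _ "(0, 1 - snd a)"]) (auto simp: D_A_iff prod_eq_iff)
  qed
  have B: "D_A \<subseteq> unit_square" "{(0, 0)} \<subseteq> unit_square" "{(0, 1 / sqrt 2)} \<subseteq> unit_square"
    using r_bounds by (auto simp: D_A_def unit_square_def one_div_r)
  have C: "{(0, 1 / r)} \<subseteq> (T_map ^^ 6) ` {(0, 1 / r)}" "{(0, 0)} \<subseteq> (T_map ^^ 1) ` {(0, 0)}"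
    using first_return_six_cycle by (auto simp add: first_return_def simp del: funpow.simps) simp
  from T[unfolded eq] show ?thesis
  proof (elim disjE exE conjE)
    fix m assume "(T_map ^^ m) (T_map z) \<in> D_set"
    hence "(T_map ^^ Suc m) z \<in> D_set" by (simp add: funpow_swap1)
    thus ?thesis unfolding eq by blast
  qed (use cycle_backward[OF B(1) A _ z] cycle_backward[OF B(2) C(2) _ z] cycle_backward[OF B(3) C(1) _ z]
       in \<open>auto simp only: eq zero_less_numeral zero_less_one\<close>)
qed

lemma resolved_step:
  assumes "resolved (y, w)" "0 \<le> x" "x < 1" "0 \<le> y" "y < 1" "0 \<le> w" "w < 1" "w - r * y + x \<in> \<int>"
  shows "resolved (x, y)"
  using resolved_backward[of "(x, y)"] T_map_eqI[of w y x] assms by (simp add: unit_square_def)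

lemma resolved_T_path: "T_path D_set (x # y # l) \<Longrightarrow> resolved (x, y)"
  using first_return_T_path[of D_set "x # y # l"] unfolding resolved_def first_return_def
  by (metis One_nat_def nth_Cons_0 nth_Cons_Suc)

text \<open>Beyond the line \<open>r * y - x = 1\<close> three steps lead into \<open>D_set\<close>.\<close>

lemma resolved_gt_1:
  assumes "0 \<le> x" "x < 1" "0 \<le> y" "y < 1" "r * y - x > 1"
  shows "resolved (x, y)"
proof (rule resolved_T_path)
  have "r + r * x < 2 * y" "r * y < r" "0 \<le> r * x"
    using r_scale(1)[OF assms(4)] r_scale(1)[OF assms(5)] assms by (auto simp: algebra_simps r_mult)
  hence *: "r + r * x < 2 * y" "r * y < r + x" "1 + x < r" "r < 2 * y" "y < r + r * x"
    using assms r_bounds by linarith+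
  show "T_path D_set [x, y, r*y - x - 1, y - r*x - r + 1, r - 1 - x]"
    using * assms r_bounds by (simp add: D_set_iff algebra_simps r_mult)
qed

text \<open>Low points of the \<open>y\<close>-axis are reflected to high ones in four steps, high ones satisfy \<open>r * y > 1\<close>;
between them lie \<open>D_A\<close> and two points of the cycle of length 6.\<close>

lemma resolved_y_axis:
  assumes "0 \<le> y" "y < 1"
  shows "resolved (0, y)"
proof -
  consider "y = 0" | "0 < y" "y < 1 - r / 2" | "y = 1 - r / 2" | "1 - r / 2 < y" "y < r / 2" | "y = r / 2" | "y > r / 2"
    using assms by linarith
  thus ?thesis
  proof cases
    case 1
    thus ?thesis by (simp add: resolved_def)
  next
    case 2
    have *: "r * y < r - 1" using r_scale(1)[OF 2(2)] by (simp add: algebra_simps r_mult)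
    have "resolved (0, 1 - y)"
      by (rule resolved_gt_1) (use * 2 r_bounds in \<open>auto simp: algebra_simps\<close>)
    hence "resolved (y, 0)" by (rule resolved_step) (use assms 2 in auto)
    hence "resolved (r * y, y)" by (rule resolved_step) (use assms * r_bounds in auto)
    hence "resolved (y, r * y)" by (rule resolved_step) (use assms * r_bounds in \<open>auto simp: r_mult\<close>)
    thus ?thesis by (rule resolved_step) (use assms * r_bounds in auto)
  next
    case 3
    have "(T_map ^^ 2) (0, 1 / r) = (0, y)"
      using T_map_eqI[of 0 "r/2" 0] T_map_eqI[of "1 - r/2" 0 "r/2"] r_bounds
      by (simp add: eval_nat_numeral one_div_r 3 r_mult del: T_map.simps)
    moreover have "(2 :: nat) \<le> 5" by simp
    ultimately show ?thesis unfolding resolved_def by metis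
  next
    case 4
    hence "(0, y) \<in> (T_map ^^ 0) ` D_A" by (simp add: D_A_iff)
    thus ?thesis unfolding resolved_def by blast
  next
    case 5
    hence "(0, y) = (T_map ^^ 0) (0, 1 / r)" by (simp add: one_div_r)
    thus ?thesis unfolding resolved_def by blast
  next
    case 6
    thus ?thesis
      using resolved_gt_1[of 0 y] assms r_scale(1)[OF 6] by (simp add: r_mult)
  qed
qed

lemma resolved_x_axis:
  assumes "0 \<le> x" "x < 1"
  shows "resolved (x, 0)"
proof (cases "x = 0")
  case False
  show ?thesis
    by (rule resolved_step[OF resolved_y_axis[of "1 - x"]]) (use assms False in auto)
qed (simp add: resolved_def)

lemma resolved_ge_1:
  assumes "0 \<le> x" "x < 1" "0 \<le> y" "y < 1" "r * y - x \<ge> 1"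
  shows "resolved (x, y)"
proof (cases "r * y - x = 1")
  case True
  show ?thesis
    by (rule resolved_step[OF resolved_x_axis[of y]]) (use assms True in \<open>auto simp: algebra_simps\<close>)
qed (use assms resolved_gt_1 in auto)

lemma resolved_diagonal:
  assumes "0 \<le> x" "r * x < 1"
  shows "resolved (x, r * x)"
proof -
  have "x < 1" "0 \<le> r * x" using assms r_bounds mult_right_mono[of 1 r x] by auto
  with assms have "resolved (r * x, x)"
    by (intro resolved_step[OF resolved_x_axis[of x]]) auto
  thus ?thesis by (rule resolved_step) (use assms \<open>x < 1\<close> \<open>0 \<le> r * x\<close> in \<open>auto simp: r_mult\<close>)
qed

text \<open>If \<open>r * y - x < 0\<close> and \<open>r * x - y > r - 1\<close>, the third iterate is \<open>(r - r * x + y, 1 - x)\<close>. The points off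
the axes that are not in \<open>D_set\<close> after two steps form the triangle \<open>y \<ge> 2 - r\<close>, which three steps carry into
the region of points that do reach \<open>D_set\<close> in two, and the triangle \<open>x \<le> r - 1\<close>, which three
steps carry into the triangle \<open>y \<ge> 2 - r\<close>.\<close>

lemma resolved_neg:
  assumes "0 \<le> x" "x < 1" "0 \<le> y" "y < 1" "r * y - x < 0"
  shows "resolved (x, y)"
proof -
  have direct: "resolved (x, y)"
    if "x < 1" "0 < y" "y < 2 - r" "r * y - x < 0" "r - 1 < r * x - y" "r - 1 < x" for x y
  proof (rule resolved_T_path)
    have "0 < r * y" "r * x < r" using that by auto
    hence "x < 1 + r * y" "r * x < r + y" using that by linarith+
    thus "T_path D_set [x, y, r*y - x + 1, r - r*x + y]"
      using that r_bounds by (simp add: D_set_iff algebra_simps r_mult)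
  qed
  have three_steps: "resolved (x, y)"
    if "resolved (r - r * x + y, 1 - x)" "0 < x" "x < 1" "0 < y" "y < 1" "r * y - x < 0" "r - 1 < r * x - y" for x y
  proof -
    have "0 < r * y" "r * x < r" using that by auto
    hence *: "x < 1 + r * y" "r * x < r + y" using that by linarith+
    have "resolved (r * y - x + 1, r - r*x + y)"
      by (rule resolved_step[OF that(1)]) (use that * r_bounds in \<open>auto simp: algebra_simps r_mult\<close>)
    hence "resolved (y, r * y - x + 1)"
      by (rule resolved_step) (use that * r_bounds in \<open>auto simp: algebra_simps r_mult\<close>)
    thus ?thesis
      by (rule resolved_step) (use that * r_bounds in \<open>auto simp: algebra_simps r_mult\<close>)
  qed
  have high: "resolved (x, y)"
    if "x < 1" "2 - r \<le> y" "r * y - x < 0" "r - 1 < r * x - y" for x y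
  proof -
    have "2 * r - 2 \<le> r * y" "r * x < r" "2 * y < r * x"
      using r_scale(2)[OF that(2)] r_scale(1)[OF that(3)] that
      by (auto simp: algebra_simps r_mult)
    hence *: "2 * r - 2 \<le> r * y" "r * x < 1 + y" "0 < x" "0 < y" "y < 1"
      using that r_bounds by linarith+
    have "resolved (r - r * x + y, 1 - x)"
      by (rule direct) (use that * r_bounds in \<open>auto simp: algebra_simps r_mult\<close>)
    thus ?thesis by (rule three_steps) (use that * in auto)
  qed
  consider "y = 0" | "r * x - y \<le> r - 1" | "0 < y" "r - 1 < r * x - y" "x > r - 1" "y < 2 - r"
    | "r - 1 < r * x - y" "2 - r \<le> y" | "0 < y" "r - 1 < r * x - y" "x \<le> r - 1"
    using assms by linarith
  thus ?thesis
  proof cases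
    case 1
    thus ?thesis using resolved_x_axis assms by simp
  next
    case 2
    have "0 \<le> r * y" using assms by simp
    hence *: "x \<le> 1 + r * y" using assms by linarith
    show ?thesis
      by (rule resolved_step[OF resolved_ge_1[of y "r * y - x + 1"]]) (use assms(1-4) assms(5) 2 * in \<open>auto simp: algebra_simps r_mult\<close>)
  next
    case 3
    thus ?thesis using direct assms by simp
  next
    case 4
    thus ?thesis using high assms by simp
  next
    case 5
    have "r * x \<le> 2 - r" "0 < r * y"
      using r_scale(2)[OF 5(3)] 5 by (auto simp: algebra_simps r_mult)
    hence *: "r * x \<le> 2 - r" "x < 2 - r + r * y" "0 < x"
      using 5 assms(5) r_bounds by linarith+
    have "resolved (r - r * x + y, 1 - x)"
      by (rule high) (use assms 5 * r_bounds in \<open>auto simp: algebra_simps r_mult\<close>)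
    thus ?thesis by (rule three_steps) (use assms 5 * r_bounds in \<open>auto simp: algebra_simps r_mult\<close>)
  qed
qed

text \<open>If no integer is added in the first step, then \<open>r * y - x\<close> becomes \<open>- (r * x - y)\<close> and \<open>r * x - y\<close> becomes
\<open>x\<close>. So a positive \<open>r * x - y\<close> leads to the case \<open>r * y - x < 0\<close> in one step, and a negative one to a
positive one or beyond the line \<open>r * y - x = 1\<close>.\<close>

lemma resolved_unit_square:
  assumes "z \<in> unit_square"
  shows "resolved z"
proof -
  have pos: "resolved (x, y)"
    if "0 \<le> x" "x < 1" "0 \<le> y" "y < 1" "0 \<le> r * y - x" "r * y - x < 1" "0 < r * x - y" for x y
    by (rule resolved_step[OF resolved_neg[of y "r * y - x"]])
      (use that in \<open>auto simp: algebra_simps r_mult\<close>)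
  obtain x y where z: "z = (x, y)" by (cases z)
  hence xy: "0 \<le> x" "x < 1" "0 \<le> y" "y < 1" using assms by (auto simp: unit_square_def)
  consider "r * y - x < 0" | "1 \<le> r * y - x" | "x = 0" | "y = r * x" | "0 \<le> r * y - x" "r * y - x < 1" "0 < r * x - y"
   | "0 < x" "0 \<le> r * y - x" "r * y - x < 1" "r * x - y < 0" "r * x - y > -1"
   | "0 < x" "0 \<le> r * y - x" "r * y - x < 1" "r * x - y \<le> -1"
    using xy by linarith
  thus ?thesis
  proof cases
    case 6
    show ?thesis unfolding z
      by (rule resolved_step[OF pos[of y "r * y - x"]]) (use 6 xy in \<open>auto simp: algebra_simps r_mult\<close>)
  next
    case 7
    show ?thesis unfolding z
      by (rule resolved_step[OF resolved_ge_1[of y "r * y - x"]]) (use 7 xy in \<open>auto simp: algebra_simps r_mult\<close>)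
  qed (use xy resolved_neg resolved_ge_1 resolved_y_axis resolved_diagonal pos in \<open>auto simp: z\<close>)
qed

text \<open>In the left piece, membership in \<open>swap_V ` D_set\<close> means that \<open>r * y - x\<close> and \<open>r * x - y\<close> are below
\<open>3 * r - 4 = (r - 1) * (2 - r)\<close> and \<open>y < r - 1\<close>. If \<open>y\<close> or \<open>r * y - x\<close> is too large, one step
suffices. The value of \<open>r * x - y\<close> becomes that of \<open>r * y - x\<close> after one step, so if only the former
is too large, two steps suffice.\<close>

lemma visits_swap_V_image:
  assumes "(x, y) \<in> D_set" "x < r - 1"
  shows "\<exists>m. (T_hat ^^ m) (x, y) \<in> swap_V ` D_set"
proof -
  have one_step: "T_hat (x, y) \<in> swap_V ` D_set"
    if "(x, y) \<in> D_set" "x < r - 1" "r - 1 \<le> y \<or> 3 * r - 4 \<le> r * y - x" for x y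
  proof -
    have *: "r * x < 2 - r" using r_scale(1)[OF that(2)] by (auto simp: algebra_simps r_mult)
    show ?thesis
      using that(3)
    proof (elim disjE)
      assume y: "r - 1 \<le> y"
      show ?thesis
        using D_ineqs[OF that(1)] that(2) y *(1) r_scale(2)[OF y] r_bounds
        by (simp add: T_hat_left[OF that(1,2)] swap_V_image_iff D_set_iff algebra_simps r_mult)
    next
      assume u: "3 * r - 4 \<le> r * y - x"
      show ?thesis
        using D_ineqs[OF that(1)] that(2) u *(1) r_scale(2)[OF u] r_bounds
        by (simp add: T_hat_left[OF that(1,2)] swap_V_image_iff D_set_iff algebra_simps r_mult)
    qed
  qed
  have "T_hat (T_hat (x, y)) \<in> swap_V ` D_set"
    if "(x, y) \<in> D_set" "x < r - 1" "3 * r - 4 \<le> r * x - y" "y < r - 1" "r * y - x < 3 * r - 4" for x y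
  proof -
    have *: "6 - 4 * r \<le> 2 * x - r * y"
      using r_scale(2)[OF that(3)] by (auto simp: algebra_simps r_mult)
    have eq: "T_hat (x, y) = (2 - r - y, x - r*y + r - 1)" using T_hat_left that by simp
    show ?thesis unfolding eq
      by (rule one_step) (use T_hat_in_D[OF that(1)] D_ineqs[OF that(1)] that(2-) * r_bounds in \<open>simp_all add: eq algebra_simps r_mult\<close>)
  qed
  hence two_steps: "T_hat (T_hat (x, y)) \<in> swap_V ` D_set"
    if "3 * r - 4 \<le> r * x - y" "y < r - 1" "r * y - x < 3 * r - 4" using assms that by blast
  have no_step: "(x, y) \<in> swap_V ` D_set"
    if "(x, y) \<in> D_set" "x < r - 1" "r * x - y < 3 * r - 4" "y < r - 1" "r * y - x < 3 * r - 4" for x y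
    using D_ineqs[OF that(1)] that(2-) that(2-)[THEN r_scale(1)] r_bounds
    by (simp add: swap_V_image_iff D_set_iff algebra_simps r_mult)
  have "(x, y) \<in> swap_V ` D_set \<or> T_hat (x, y) \<in> swap_V ` D_set
      \<or> T_hat (T_hat (x, y)) \<in> swap_V ` D_set"
    using one_step[OF assms] two_steps no_step[OF assms] by linarith
  hence "(T_hat ^^ 0) (x, y) \<in> swap_V ` D_set \<or> (T_hat ^^ 1) (x, y) \<in> swap_V ` D_set
      \<or> (T_hat ^^ 2) (x, y) \<in> swap_V ` D_set"
    by (simp add: eval_nat_numeral)
  thus ?thesis by blast
qed

text \<open>The points with \<open>y < r - 1 \<le> x\<close> are mapped to the left piece, since there \<open>T_hat (x, y)\<close> has first coordinate \<open>y\<close>.\<close>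

lemma P_set_lower_bounds:
  assumes "(x, y) \<in> P_set"
  shows "(x, y) \<in> D_set" "r - 1 \<le> x" "r - 1 \<le> y"
proof -
  show D: "(x, y) \<in> D_set" using assms by (simp add: P_set_def)
  have no: "(T_hat ^^ m) (x, y) \<notin> swap_V ` D_set" for m
    using assms by (auto simp: P_set_def T_hat_iter_def image_U_map_D dest: spec[of _ "int m"])
  show x: "r - 1 \<le> x" using visits_swap_V_image[OF D] no by force
  have "\<not> y < r - 1"
  proof
    assume y: "y < r - 1"
    obtain w where w: "T_hat (x, y) = (y, w)"
      using T_hat_right[OF D] T_hat_vertical[of y] D x y by (cases "x = r - 1") auto
    then obtain m where "(T_hat ^^ m) (T_hat (x, y)) \<in> swap_V ` D_set"
      using visits_swap_V_image[of y w] y T_hat_in_D[OF D] by auto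
    thus False using no[of "Suc m"] by (simp add: funpow_swap1)
  qed
  thus "r - 1 \<le> y" by simp
qed

section \<open>Periods of the individual points\<close>

lemma prime_dvd_power_two: "prime p \<Longrightarrow> p dvd 2 ^ k \<Longrightarrow> p = (2 :: nat)"
  by (metis prime_dvd_power primes_dvd_imp_eq two_is_prime_nat)

lemma T_hat_D_alpha:
  assumes "v \<in> D_alpha"
  shows "T_hat v = oct_rot v" "oct_rot v \<in> D_alpha"
proof -
  obtain x y where v: "v = (x, y)" by (cases v)
  have D: "(x, y) \<in> D_set" "x > r - 1" "y > r - 1" using assms by (auto simp: v D_alpha_def)
  show *: "T_hat v = oct_rot v" using T_hat_oct[OF D] by (simp add: v oct_rot_def)
  show "oct_rot v \<in> D_alpha"
    using T_hat_in_D[OF D(1)] * D_ineqs[OF D(1)] D by (auto simp: v oct_rot_def D_alpha_def)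
qed

lemma T_hat_funpow_D_alpha:
  assumes "v \<in> D_alpha"
  shows "(T_hat ^^ i) v = (oct_rot ^^ i) v \<and> (oct_rot ^^ i) v \<in> D_alpha"
  by (induction i) (use assms T_hat_D_alpha in auto)

lemma height_D_alpha: "v \<in> D_alpha \<Longrightarrow> height n v = height_oct n"
  by (cases v) (auto simp: D_alpha_def)

text \<open>Half a turn about the centre, which moves every other point.\<close>

lemma oct_rot_4: "(oct_rot ^^ 4) v = (r - fst v, r - snd v)"
  by (simp add: eval_nat_numeral oct_rot_def) (simp add: algebra_simps r_mult)

lemma center_D_alpha: "(1 / r, 1 / r) \<in> D_alpha"
  unfolding one_div_r using r_bounds by (simp add: D_alpha_def D_set_iff r_mult)

lemma min_period_center: "min_period ((swap_V ^^ n) (1 / r, 1 / r)) = enat (height_oct n)"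
proof -
  have "T_hat (1 / r, 1 / r) = (1 / r, 1 / r)"
    using T_hat_D_alpha(1)[OF center_D_alpha] by (simp add: oct_rot_def one_div_r r_mult)
  thus ?thesis
    using min_period_swap_V[of "(1 / r, 1 / r)" 1 n] center_D_alpha height_D_alpha[OF center_D_alpha]
    by (auto simp: D_alpha_def)
qed

lemma min_period_D_alpha:
  assumes "v \<in> D_alpha" "v \<noteq> (1 / r, 1 / r)"
  shows "min_period ((swap_V ^^ n) v) = enat (8 * height_oct n)"
proof -
  note iter = T_hat_funpow_D_alpha[OF assms(1)]
  have D: "v \<in> D_set" using assms by (auto simp: D_alpha_def)
  have 4: "(T_hat ^^ 4) v = (r - fst v, r - snd v)" using iter oct_rot_4 by simp
  have "(oct_rot ^^ (4 + 4)) v = v" unfolding funpow_add by (simp add: oct_rot_4)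
  hence 8: "(T_hat ^^ 8) v = v" using iter by simp
  have "(T_hat ^^ (8 div p)) v \<noteq> v"
    if "prime p" "p dvd 8" for p :: nat
  proof -
    have "p = 2" using prime_dvd_power_two[of p 3] that by simp
    moreover have "(T_hat ^^ 4) v \<noteq> v"
      using assms(2) unfolding 4 one_div_r by (cases v) auto
    ultimately show ?thesis by simp
  qed
  hence "min_period ((swap_V ^^ n) v) = enat (\<Sum>i<8. height n ((T_hat ^^ i) v))"
    using min_period_swap_V[OF D _ 8] by simp
  thus ?thesis using iter by (simp add: height_D_alpha)
qed

lemma edge_in_D:
  assumes "r - 1 \<le> x" "x < 2 - r"
  shows "(x, r - 1) \<in> D_set" "(r - 1, x) \<in> D_set"
proof -
  have "2 - r \<le> r * x" "r * x < 2 * r - 2"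
    using r_scale(2)[OF assms(1)] r_scale(1)[OF assms(2)] by (auto simp: algebra_simps r_mult)
  thus "(x, r - 1) \<in> D_set" "(r - 1, x) \<in> D_set"
    using assms r_bounds by (auto simp: D_set_iff algebra_simps r_mult)
qed

lemma D_left_edge_bound:
  assumes "(r - 1, y) \<in> D_set"
  shows "y < 2 - r"
  using D_ineqs[OF assms] by (simp add: algebra_simps r_mult)

text \<open>On the two boundary segments next to the octagon, two steps of the induced map are the
reflection of the segment in its midpoint.\<close>

lemma T_hat_boundary:
  assumes "r - 1 < x" "x < 2 - r"
  shows "T_hat (x, r - 1) = (r - 1, 1 - x)" "T_hat (r - 1, x) = (x, r - 1)"
  using T_hat_right[OF edge_in_D(1), of x] T_hat_vertical[OF edge_in_D(2), of x] assms
  by (auto simp: algebra_simps r_mult)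

lemma min_period_corner: "min_period ((swap_V ^^ n) (r - 1, r - 1)) = enat (height_edge n)"
  using min_period_swap_V[of "(r - 1, r - 1)" 1 n] edge_in_D[of "r - 1"] T_hat_vertical[of "r - 1"] r_bounds
  by auto

lemma min_period_beta_mid:
  "v \<in> {(1 / 2, r - 1), (r - 1, 1 / 2)} \<Longrightarrow>
     min_period ((swap_V ^^ n) v) = enat (3 * height_oct n + height_edge n)"
proof -
  assume v: "v \<in> {(1 / 2, r - 1), (r - 1, 1 / 2)}"
  have h: "r - 1 < 1 / 2" "1 / 2 < 2 - r" using r_bounds by auto
  have D: "v \<in> D_set" using v edge_in_D[of "1/2"] h by auto
  have 2: "(T_hat ^^ 2) v = v" using v T_hat_boundary[OF h] by (auto simp: eval_nat_numeral)
  have ne: "T_hat v \<noteq> v" using v T_hat_boundary[OF h] h by auto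
  have "(T_hat ^^ (2 div p)) v \<noteq> v"
    if "prime p" "p dvd 2" for p :: nat
    using prime_dvd_power_two[of p 1] that ne by simp
  hence "min_period ((swap_V ^^ n) v) = enat (\<Sum>i<2. height n ((T_hat ^^ i) v))"
    using min_period_swap_V[OF D _ 2] by simp
  also have "(\<Sum>i<2. height n ((T_hat ^^ i) v)) = 3 * height_oct n + height_edge n"
    using v T_hat_boundary[OF h] h by (auto simp: eval_nat_numeral)
  finally show ?thesis .
qed

lemma min_period_beta:
  assumes x: "r - 1 < x" "x < 2 - r" "x \<noteq> 1 / 2" and v: "v = (x, r - 1) \<or> v = (r - 1, x)"
  shows "min_period ((swap_V ^^ n) v) = enat (2 * (3 * height_oct n + height_edge n))"
proof -
  have D: "v \<in> D_set" using v edge_in_D[of x] x by auto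
  note T = T_hat_boundary[OF x(1,2)] T_hat_boundary[of "1 - x"]
  have 2: "(T_hat ^^ 2) v \<noteq> v" using v T x by (auto simp: eval_nat_numeral)
  have 4: "(T_hat ^^ 4) v = v" using v T x by (auto simp: eval_nat_numeral)
  have "(T_hat ^^ (4 div p)) v \<noteq> v"
    if "prime p" "p dvd 4" for p :: nat
    using prime_dvd_power_two[of p 2] that 2 by simp
  hence "min_period ((swap_V ^^ n) v) = enat (\<Sum>i<4. height n ((T_hat ^^ i) v))"
    using min_period_swap_V[OF D _ 4] by simp
  also have "(\<Sum>i<4. height n ((T_hat ^^ i) v)) = 2 * (3 * height_oct n + height_edge n)"
    using v T x by (auto simp: eval_nat_numeral)
  finally show ?thesis .
qed

lemma T_hat_D_beta: "T_hat ` D_beta = prod.swap ` D_beta"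
proof -
  have "T_hat (x, r - 1) = prod.swap (1 - x, r - 1)"
    if "r - 1 < x" "x < 2 - r" for x
    using T_hat_boundary(1)[OF that] by simp
  hence "T_hat ` D_beta \<subseteq> prod.swap ` D_beta"
    by (force simp: D_beta_def)
  moreover have "prod.swap (x, r - 1) \<in> T_hat ` D_beta"
    if "r - 1 < x" "x < 2 - r" for x
  proof (rule image_eqI)
    show "prod.swap (x, r - 1) = T_hat (1 - x, r - 1)"
      using T_hat_boundary(1)[of "1 - x"] that by simp
    show "(1 - x, r - 1) \<in> D_beta" using that by (simp add: D_beta_def)
  qed
  hence "prod.swap ` D_beta \<subseteq> T_hat ` D_beta" by (auto simp: D_beta_def)
  ultimately show ?thesis by blast
qed

lemma min_period_on_orbit:
  "\<exists>m\<le>k. z = (T_map ^^ m) a \<Longrightarrow> a \<in> unit_square \<Longrightarrow> min_period z = min_period a"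
  by (elim exE conjE) (simp only: min_period_funpow)

lemma min_period_SnR_swap_V:
  assumes s: "admissible_choice s" "z \<in> unit_square" "SnR s n z = Some w"
    and eq: "\<And>v. v = w \<or> v = prod.swap w \<Longrightarrow> min_period ((swap_V ^^ n) v) = p"
  shows "min_period z = p"
  using min_period_SnR[OF s] eq by (simp add: U_map_funpow split: if_splits)

theorem theorem5p1:
  fixes s :: "point \<Rightarrow> int" and z :: point
  assumes "admissible_choice s"
    and "z \<in> unit_square"
  shows "(z = (0, 0) \<longrightarrow> min_period z = 1)
    \<and> ((\<exists>m\<le>3. z = (T_map ^^ m) (0, 1/2)) \<longrightarrow> min_period z = 4)
    \<and> ((\<exists>m\<le>3. z \<in> (T_map ^^ m) ` D_A) \<and> \<not> (\<exists>m\<le>3. z = (T_map ^^ m) (0, 1/2))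
        \<longrightarrow> min_period z = 8)
    \<and> ((\<exists>m\<le>5. z = (T_map ^^ m) (0, 1 / sqrt 2)) \<longrightarrow> min_period z = 6)
    \<and> (\<forall>n. SnR s n z = Some (1 / sqrt 2, 1 / sqrt 2)
        \<longrightarrow> min_period z = enat (nat (2 * 3 ^ n + (-1) ^ n)))
    \<and> (\<forall>n. (\<exists>w \<in> D_alpha - {(1 / sqrt 2, 1 / sqrt 2)}. SnR s n z = Some w)
        \<longrightarrow> min_period z = enat (nat (8 * (2 * 3 ^ n + (-1) ^ n))))
    \<and> (\<forall>n. (\<exists>w \<in> {(1/2, sqrt 2 - 1), (sqrt 2 - 1, 1/2)}. SnR s n z = Some w)
        \<longrightarrow> min_period z = enat (nat (4 * (3 ^ (n + 1) + 1 + (-1) ^ n))))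
    \<and> (\<forall>n. (\<exists>w \<in> (D_beta \<union> T_hat ` D_beta) - {(1/2, sqrt 2 - 1), (sqrt 2 - 1, 1/2)}.
              SnR s n z = Some w)
        \<longrightarrow> min_period z = enat (nat (8 * (3 ^ (n + 1) + 1 + (-1) ^ n))))
    \<and> (\<forall>n. SnR s n z = Some (sqrt 2 - 1, sqrt 2 - 1)
        \<longrightarrow> min_period z = enat (nat (2 * 3 ^ (n + 1) + 4 + (-1) ^ n)))
    \<and> ((\<forall>n. \<exists>w \<in> D_set - P_set. SnR s n z = Some w) \<longrightarrow> min_period z = \<infinity>)
    \<and> (z = (0, 0)
       \<or> (\<exists>m\<le>3. z \<in> (T_map ^^ m) ` D_A)
       \<or> (\<exists>m\<le>5. z = (T_map ^^ m) (0, 1 / sqrt 2))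
       \<or> (\<exists>n. \<exists>w \<in> D_alpha \<union> D_beta \<union> T_hat ` D_beta
                 \<union> {(1 / sqrt 2, 1 / sqrt 2), (1/2, sqrt 2 - 1), (sqrt 2 - 1, 1/2),
                    (sqrt 2 - 1, sqrt 2 - 1)}. SnR s n z = Some w)
       \<or> (\<forall>n. \<exists>w \<in> D_set - P_set. SnR s n z = Some w))"
proof -
  note via_R = min_period_SnR_swap_V[OF assms]
  have nat_A: "nat (2 * 3 ^ n + (-1) ^ n) = height_oct n" for n
    by (simp flip: height_oct_closed)
  have nat_A8: "nat (8 * (2 * 3 ^ n + (-1) ^ n)) = 8 * height_oct n" for n
    by (simp add: nat_mult_distrib flip: height_oct_closed)
  have nat_E: "nat (2 * 3 ^ (n + 1) + 4 + (-1) ^ n) = height_edge n" for n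
    by (simp only: nat_int flip: height_edge_closed)
  have edge: "4 * (3 ^ (n + 1) + 1 + (-1) ^ n) = int (3 * height_oct n + height_edge n)" for n
    by (simp add: height_oct_closed height_edge_closed algebra_simps)
  have nat_edge: "nat (4 * (3 ^ (n + 1) + 1 + (-1) ^ n)) = 3 * height_oct n + height_edge n" for n
    unfolding edge by simp
  have nat_edge2: "nat (8 * (3 ^ (n + 1) + 1 + (-1) ^ n)) = 2 * (3 * height_oct n + height_edge n)" for n
  proof -
    have "8 * (3 ^ (n + 1) + 1 + (-1) ^ n) = int (2 * (3 * height_oct n + height_edge n))"
      by (simp add: height_oct_closed height_edge_closed algebra_simps)
    thus ?thesis by (simp only: nat_int)
  qed
  have c_origin: "min_period z = 1"
    if "z = (0, 0)" using that min_period_origin by simp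
  have c_four: "min_period z = 4"
    if "\<exists>m\<le>3. z = (T_map ^^ m) (0, 1/2)"
  proof -
    have "(0, 1/2) \<in> unit_square" by (simp add: unit_square_def)
    from min_period_on_orbit[OF that this] show ?thesis
      using min_period_eqI[OF first_return_four_cycle] by (simp only: numeral_eq_enat)
  qed
  have c_eight: "min_period z = 8"
    if "(\<exists>m\<le>3. z \<in> (T_map ^^ m) ` D_A) \<and> \<not> (\<exists>m\<le>3. z = (T_map ^^ m) (0, 1/2))"
  proof -
    from that have ex: "\<exists>m\<le>3. z \<in> (T_map ^^ m) ` D_A"
      and mid: "\<not> (\<exists>m\<le>3. z = (T_map ^^ m) (0, 1/2))" by simp_all
    from ex obtain m where m: "m \<le> 3" "z \<in> (T_map ^^ m) ` D_A" by blast
    from m(2) obtain a where z: "z = (T_map ^^ m) a" and "a \<in> D_A" by (rule imageE)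
    obtain y where a: "a = (0, y)" "1 - r / 2 < y" "y < r / 2"
      using \<open>a \<in> D_A\<close> by (cases a) (auto simp: D_A_iff)
    have "y \<noteq> 1 / 2"
    proof
      assume "y = 1 / 2"
      hence "m \<le> 3 \<and> z = (T_map ^^ m) (0, 1/2)" using m(1) z a(1) by (simp only: simp_thms)
      with mid show False by (rule notE[OF _ exI])
    qed
    hence "min_period a = 8"
      using min_period_eqI[OF first_return_D_A[OF a(2,3)]] by (simp add: a numeral_eq_enat)
    moreover have "a \<in> unit_square" using a r_bounds by (simp add: unit_square_def)
    ultimately show ?thesis unfolding z by (simp only: min_period_funpow)
  qed
  have c_six: "min_period z = 6"
    if "\<exists>m\<le>5. z = (T_map ^^ m) (0, 1 / sqrt 2)"
  proof -
    have "(0, 1 / r) \<in> unit_square" using r_bounds by (simp add: unit_square_def one_div_r)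
    from min_period_on_orbit[OF that this] show ?thesis
      using min_period_eqI[OF first_return_six_cycle] by (simp only: numeral_eq_enat)
  qed
  have c_center: "min_period z = enat (nat (2 * 3 ^ n + (-1) ^ n))"
    if "SnR s n z = Some (1 / sqrt 2, 1 / sqrt 2)" for n
    unfolding nat_A by (rule via_R[OF that]) (use min_period_center in auto)
  have c_alpha: "min_period z = enat (nat (8 * (2 * 3 ^ n + (-1) ^ n)))"
    if "\<exists>w \<in> D_alpha - {(1 / sqrt 2, 1 / sqrt 2)}. SnR s n z = Some w" for n
  proof -
    from that obtain w where w: "w \<in> D_alpha" "w \<noteq> (1 / r, 1 / r)" "SnR s n z = Some w" by auto
    have "prod.swap w \<in> D_alpha" "prod.swap w \<noteq> (1 / r, 1 / r)"
      using w swap_in_D[of w] by (cases w; auto simp: D_alpha_def)+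
    thus ?thesis unfolding nat_A8
      by (intro via_R[OF w(3)], elim disjE) (use w min_period_D_alpha in blast)+
  qed
  have c_mid: "min_period z = enat (nat (4 * (3 ^ (n + 1) + 1 + (-1) ^ n)))"
    if "\<exists>w \<in> {(1/2, sqrt 2 - 1), (sqrt 2 - 1, 1/2)}. SnR s n z = Some w" for n
  proof -
    from that obtain w where w: "w \<in> {(1 / 2, r - 1), (r - 1, 1 / 2)}" "SnR s n z = Some w" by blast
    show ?thesis unfolding nat_edge
      by (rule via_R[OF w(2)], rule min_period_beta_mid) (use w(1) in auto)
  qed
  have c_edge: "min_period z = enat (nat (8 * (3 ^ (n + 1) + 1 + (-1) ^ n)))"
    if "\<exists>w \<in> (D_beta \<union> T_hat ` D_beta) - {(1/2, sqrt 2 - 1), (sqrt 2 - 1, 1/2)}.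
              SnR s n z = Some w" for n
  proof -
    from that[unfolded T_hat_D_beta] obtain w where w: "w \<in> D_beta \<union> prod.swap ` D_beta" "w \<notin> {(1/2, r - 1), (r - 1, 1/2)}"
      "SnR s n z = Some w" by blast
    obtain x where x: "r - 1 < x" "x < 2 - r" "w = (x, r - 1) \<or> w = (r - 1, x)"
      using w(1) by (auto simp: D_beta_def)
    have "x \<noteq> 1 / 2" using x(3) w(2) by auto
    show ?thesis unfolding nat_edge2
      by (rule via_R[OF w(3)], rule min_period_beta[OF x(1,2) \<open>x \<noteq> 1 / 2\<close>]) (use x(3) in auto)
  qed
  have c_corner: "min_period z = enat (nat (2 * 3 ^ (n + 1) + 4 + (-1) ^ n))"
    if "SnR s n z = Some (sqrt 2 - 1, sqrt 2 - 1)" for n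
    unfolding nat_E by (rule via_R[OF that]) (use min_period_corner in auto)
  have c_inf: "min_period z = \<infinity>"
    if "\<forall>n. \<exists>w \<in> D_set - P_set. SnR s n z = Some w"
  proof (rule ccontr)
    assume "min_period z \<noteq> \<infinity>"
    then obtain p where p: "min_period z = enat p" by auto
    from that obtain w where "w \<in> D_set" "SnR s p z = Some w" by blast
    \<comment> \<open>the level is chosen to be the supposed period, which the heights at that level exceed\<close>
    define v where "v = (if even p then w else prod.swap w)"
    have "v \<in> D_set" using \<open>w \<in> D_set\<close> by (simp add: v_def swap_in_D)
    moreover have "min_period z = min_period ((swap_V ^^ p) v)"
      using min_period_SnR[OF assms \<open>SnR s p z = Some w\<close>] by (simp add: U_map_funpow v_def)
    ultimately have "enat (height p v) \<le> enat p" using min_period_height_le[of v p] p by metis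
    thus False using less_height[of p v] by simp
  qed
  have c_all: "z = (0, 0)
       \<or> (\<exists>m\<le>3. z \<in> (T_map ^^ m) ` D_A)
       \<or> (\<exists>m\<le>5. z = (T_map ^^ m) (0, 1 / sqrt 2))
       \<or> (\<exists>n. \<exists>w \<in> D_alpha \<union> D_beta \<union> T_hat ` D_beta
                 \<union> {(1 / sqrt 2, 1 / sqrt 2), (1/2, sqrt 2 - 1), (sqrt 2 - 1, 1/2),
                    (sqrt 2 - 1, sqrt 2 - 1)}. SnR s n z = Some w)
       \<or> (\<forall>n. \<exists>w \<in> D_set - P_set. SnR s n z = Some w)"
  proof (cases "z \<in> R_set")
    case True
    thus ?thesis using resolved_unit_square[OF assms(2)] by (auto simp: R_set_def resolved_def)
  next
    case False
    have P: "w \<in> D_alpha \<union> D_beta \<union> T_hat ` D_beta \<union> {(r - 1, r - 1)}"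
      if "w \<in> P_set" for w
    proof -
      obtain x y where w: "w = (x, y)" by (cases w)
      note xy = P_set_lower_bounds[OF that[unfolded w]]
      have "(y, x) \<in> D_set" using xy(1) swap_in_D[of w] by (simp add: w)
      hence "x = r - 1 \<Longrightarrow> y < 2 - r" "y = r - 1 \<Longrightarrow> x < 2 - r"
        using D_left_edge_bound[of y] D_left_edge_bound[of x] xy(1) by auto
      thus ?thesis using xy unfolding T_hat_D_beta w
        by (cases "x = r - 1"; cases "y = r - 1") (auto simp: D_alpha_def D_beta_def image_iff)
    qed
    \<comment> \<open>renormalization either goes on at level \<open>n\<close> or has stopped in \<open>P_set\<close> at some level\<close>
    have "(\<exists>w \<in> D_set - P_set. SnR s n z = Some w) \<or> (\<exists>n. \<exists>w \<in> P_set. SnR s n z = Some w)" for n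
    proof (induction n)
      case 0
      obtain w where "SnR s 0 z = Some w" using False by simp
      thus ?case using min_period_SnR[OF assms] by blast
    next
      case (Suc n)
      thus ?case
      proof
        assume "\<exists>w \<in> D_set - P_set. SnR s n z = Some w"
        then obtain v where "v \<in> D_set - P_set" "SnR s n z = Some v" by blast
        hence "SnR s (Suc n) z = Some (S_map s v)" by simp
        thus ?case using min_period_SnR[OF assms] by blast
      qed blast
    qed
    thus ?thesis using P by blast
  qed
  show ?thesis
    by (intro conjI allI impI c_all)
      (erule c_origin | erule c_four | erule c_eight | erule c_six
       | erule c_center | erule c_alpha | erule c_mid | erule c_edge | erule c_corner | erule c_inf)+
qed

end
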